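(* Let $n\ge 2$, $d\ge 1$ and $s\ge 1$ be integers with $s\le \binom{n+d-1}{n-1}$. Let $\ell_1,\dots,\ell_s\in [S]_1$ be general linear forms, let $F_s=\ell_1^d+\cdots+\ell_s^d\in [S]_d$, and let $A_{F_s}=R/\operatorname{Ann}_R(F_s)$, an Artinian Gorenstein graded $\mathbb{K}$-algebra of socle degree $d$ with Macaulay dual generator $F_s$. Then the Hilbert function $h_k=\dim_{\mathbb{K}}[A_{F_s}]_k$ is given by $$h_k=\min\left\{\binom{n+k-1}{k},\,s\right\}\quad\text{for } 0\le k\le \left\lfloor \tfrac d2\right\rfloor,$$ and by symmetry, $h_k=h_{d-k}$, for $\lfloor \tfrac d2\rfloor<k\le d$.
   Context: $\mathbb{K}$ is an algebraically closed field of characteristic zero, $R=\mathbb{K}[x_1,\dots,x_n]$ and $S=\mathbb{K}[X_1,\dots,X_n]$, both with the standard grading; $[M]_k$ denotes the degree-$k$ component of a graded module $M$. $R$ acts on $S$ by differentiation, $x_i=\partial/\partial X_i$; for $F\in S$, $\operatorname{Ann}_R(F)=\{p\in R : p(\partial/\partial X_1,\dots,\partial/\partial X_n)\circ F=0\}$. If $F\ne 0$ is homogeneous of degree $d$, then $R/\operatorname{Ann}_R(F)$ is an Artinian Gorenstein graded algebra of socle degree $d$, and $F$ is called its Macaulay dual generator. "General": writing $\ell_i=a_{i,1}X_1+\cdots+a_{i,n}X_n$, a statement holds for general linear forms $\ell_1,\dots,\ell_s$ if there is a nonempty (dense) Zariski open subset $U\subset \mathbb{K}^{ns}$ such that it holds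 whenever $(a_{1,1},\dots,a_{1,n},\dots,a_{s,1},\dots,a_{s,n})\in U$. *)

theory Defs
  imports
    "HOL-Library.Poly_Mapping"
    "HOL-Library.FuncSet"
    "HOL-Computational_Algebra.Polynomial"
    "HOL-Algebra.QuotRing"
    "HOL-Algebra.Embedded_Algebras"
begin

section \<open>Polynomials in several variables\<close>

text \<open>A polynomial is a finitely supported map from exponent vectors to coefficients, with the
  convolution product of \<^theory>\<open>HOL-Library.Poly_Mapping\<close>. The type does not bound the variables;
  the set of admissible variables is an explicit argument below.\<close>

type_synonym ('i, 'k) mpoly = "('i \<Rightarrow>\<^sub>0 nat) \<Rightarrow>\<^sub>0 'k"

definition polys_in :: "'i set \<Rightarrow> ('i, 'k::zero) mpoly set" where
  "polys_in I = {p. \<forall>m\<in>Poly_Mapping.keys p. Poly_Mapping.keys m \<subseteq> I}"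

definition const :: "'k::zero \<Rightarrow> ('i, 'k) mpoly" where
  "const c = Poly_Mapping.single 0 c"

definition var :: "'i \<Rightarrow> ('i, 'k::zero_neq_one) mpoly" where
  "var i = Poly_Mapping.single (Poly_Mapping.single i 1) 1"

definition mon_deg :: "('i \<Rightarrow>\<^sub>0 nat) \<Rightarrow> nat" where
  "mon_deg m = (\<Sum>i\<in>Poly_Mapping.keys m. Poly_Mapping.lookup m i)"

definition graded_part :: "'i set \<Rightarrow> nat \<Rightarrow> ('i, 'k::zero) mpoly set" where
  "graded_part I k = {p \<in> polys_in I. \<forall>m\<in>Poly_Mapping.keys p. mon_deg m = k}"

definition eval_at :: "('i \<Rightarrow> 'k) \<Rightarrow> ('i, 'k::comm_semiring_1) mpoly \<Rightarrow> 'k" where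
  "eval_at a p = (\<Sum>m\<in>Poly_Mapping.keys p.
     Poly_Mapping.lookup p m * (\<Prod>i\<in>Poly_Mapping.keys m. a i ^ Poly_Mapping.lookup m i))"

text \<open>The ring $\mathbb{K}[x_0,\dots,x_{n-1}]$. Both $R$ and $S$ are represented by it.\<close>

definition poly_ring :: "nat \<Rightarrow> (nat, 'k::comm_ring_1) mpoly ring" where
  "poly_ring n = \<lparr>carrier = polys_in {..<n}, mult = (*), one = 1, zero = 0, add = (+)\<rparr>"


section \<open>The action by differentiation\<close>

text \<open>The subtraction of exponent vectors is truncated, but where it truncates (exponent of
  $X_i$ equal to $0$) the coefficient vanishes.\<close>

definition partial_deriv :: "'i \<Rightarrow> ('i, 'k::comm_semiring_1) mpoly \<Rightarrow> ('i, 'k) mpoly" where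
  "partial_deriv i F = (\<Sum>m\<in>Poly_Mapping.keys F.
     Poly_Mapping.single (m - Poly_Mapping.single i 1)
       (of_nat (Poly_Mapping.lookup m i) * Poly_Mapping.lookup F m))"

text \<open>The operator $\partial^m = \partial_0^{m_0} \cdots \partial_{n-1}^{m_{n-1}}$.\<close>

definition monom_deriv ::
    "nat \<Rightarrow> (nat \<Rightarrow>\<^sub>0 nat) \<Rightarrow> (nat, 'k::comm_semiring_1) mpoly \<Rightarrow> (nat, 'k) mpoly" where
  "monom_deriv n m F = foldr (\<lambda>i. partial_deriv i ^^ Poly_Mapping.lookup m i) [0..<n] F"

definition diff_action ::
    "nat \<Rightarrow> (nat, 'k::comm_semiring_1) mpoly \<Rightarrow> (nat, 'k) mpoly \<Rightarrow> (nat, 'k) mpoly" where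
  "diff_action n p F =
     (\<Sum>m\<in>Poly_Mapping.keys p. const (Poly_Mapping.lookup p m) * monom_deriv n m F)"

definition Ann :: "nat \<Rightarrow> (nat, 'k::comm_semiring_1) mpoly \<Rightarrow> (nat, 'k) mpoly set" where
  "Ann n F = {p \<in> polys_in {..<n}. diff_action n p F = 0}"


section \<open>The algebra with Macaulay dual generator \<open>F\<close> and its Hilbert function\<close>

definition dual_algebra ::
    "nat \<Rightarrow> (nat, 'k::comm_ring_1) mpoly \<Rightarrow> (nat, 'k) mpoly set ring" where
  "dual_algebra n F = poly_ring n Quot Ann n F"

definition scalars ::
    "nat \<Rightarrow> (nat, 'k::comm_ring_1) mpoly \<Rightarrow> (nat, 'k) mpoly set set" where
  "scalars n F = (\<lambda>c. Ann n F +>\<^bsub>poly_ring n\<^esub> const c) ` UNIV"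

definition algebra_part ::
    "nat \<Rightarrow> (nat, 'k::comm_ring_1) mpoly \<Rightarrow> nat \<Rightarrow> (nat, 'k) mpoly set set" where
  "algebra_part n F k = (\<lambda>p. Ann n F +>\<^bsub>poly_ring n\<^esub> p) ` graded_part {..<n} k"

text \<open>The dimension is that of \<^theory>\<open>HOL-Algebra.Embedded_Algebras\<close>, taken inside the ring
  $A_F = R/\mathrm{Ann}_R(F)$ over the copy of $\mathbb{K}$ formed by the classes of the constants
  (a subfield of $A_F$ as soon as $F \neq 0$).\<close>

definition hilbert_function :: "nat \<Rightarrow> (nat, 'k::comm_ring_1) mpoly \<Rightarrow> nat \<Rightarrow> nat" where
  "hilbert_function n F k = ring.dim (dual_algebra n F) (scalars n F) (algebra_part n F k)"


section \<open>Sums of powers of linear forms and the Zariski topology\<close>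

text \<open>The coefficient of $X_j$ in the $i$-th linear form is \<open>a (i, j)\<close>.\<close>

definition linear_form ::
    "nat \<Rightarrow> (nat \<times> nat \<Rightarrow> 'k::comm_ring_1) \<Rightarrow> nat \<Rightarrow> (nat, 'k) mpoly" where
  "linear_form n a i = (\<Sum>j<n. const (a (i, j)) * var j)"

definition power_sum ::
    "nat \<Rightarrow> nat \<Rightarrow> nat \<Rightarrow> (nat \<times> nat \<Rightarrow> 'k::comm_ring_1) \<Rightarrow> (nat, 'k) mpoly" where
  "power_sum n d s a = (\<Sum>i<s. linear_form n a i ^ d)"

text \<open>$\mathbb{K}^I$ as functions that are \<^const>\<open>undefined\<close> outside \<open>I\<close>.\<close>

definition affine_space :: "'i set \<Rightarrow> ('i \<Rightarrow> 'k) set" where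
  "affine_space I = (I \<rightarrow>\<^sub>E UNIV)"

definition zero_locus :: "'i set \<Rightarrow> ('i, 'k::comm_semiring_1) mpoly set \<Rightarrow> ('i \<Rightarrow> 'k) set" where
  "zero_locus I P = {a \<in> affine_space I. \<forall>p\<in>P. eval_at a p = 0}"

definition zariski_open :: "'i set \<Rightarrow> ('i \<Rightarrow> 'k::comm_semiring_1) set \<Rightarrow> bool" where
  "zariski_open I U \<longleftrightarrow> (\<exists>P \<subseteq> polys_in I. U = affine_space I - zero_locus I P)"

end

theory Submission
  imports Defs "Jordan_Normal_Form.Determinant"
begin

text \<open>Writing \<open>\<langle>F, p\<rangle>\<close> for the value at the origin of \<open>p\<close> acting on \<open>F\<close>, a polynomial \<open>p\<close>
  annihilates \<open>F\<close> iff \<open>\<langle>F, p q\<rangle> = 0\<close> for all \<open>q\<close>. For \<open>F\<close> of degree \<open>d\<close> and \<open>p\<close> of degree \<open>k\<close> only \<open>q\<close>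
  of degree \<open>d - k\<close> matter, so \<open>h\<^sub>k\<close> is the rank of the pairing \<open>(p, q) \<mapsto> \<langle>F, p q\<rangle>\<close> between degrees \<open>k\<close>
  and \<open>d - k\<close> (lemma \<open>hilbert_function_eq_dual_system\<close>). As a rank it is symmetric in the two
  degrees, which gives \<open>h\<^sub>k = h\<^sub>d\<^sub>-\<^sub>k\<close> for every nonzero form (\<open>hilbert_function_symmetric\<close>).

  If \<open>F = \<ell>\<^sub>1\<^sup>d + \<dots> + \<ell>\<^sub>s\<^sup>d\<close> and \<open>a\<^sub>i\<close> is the coefficient vector of \<open>\<ell>\<^sub>i\<close>, then
  \<open>\<langle>F, p q\<rangle> = d! \<Sum>\<^sub>i p(a\<^sub>i) q(a\<^sub>i)\<close> (\<open>apolar_power_sum\<close>). The pairing factors through the space of forms of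
  degree \<open>k\<close> and through the \<open>s\<close> values at the points, so its rank is at most the minimum \<open>r\<close> of
  their dimensions.

  For the other inequality let \<open>2 k \<le> d\<close> and choose \<open>r\<close> monomials of degree \<open>k\<close>. Restricting \<open>q\<close> to
  multiples of \<open>x\<^sub>0\<^sup>d\<^sup>-\<^sup>2\<^sup>k\<close>, one obtains the symmetric form \<open>\<Sum>\<^sub>i a\<^sub>i\<^sub>0\<^sup>d\<^sup>-\<^sup>2\<^sup>k f(a\<^sub>i) g(a\<^sub>i)\<close> on their span, and
  its determinant is a polynomial in the coordinates of the points. The open set is where these
  determinants, for all \<open>k\<close> at once, are nonzero. It contains a point: take \<open>a\<^sub>i = (\<pi>\<^sub>0\<^sup>i, \<pi>\<^sub>1\<^sup>i, \<dots>)\<close> for distinct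
  primes \<open>\<pi>\<^sub>j\<close>. There the form has integer coefficients and positive weights, hence is definite as soon
  as no nonzero combination of the chosen monomials vanishes at all \<open>s\<close> points; and the matrix of
  values of the monomials at the points is a Vandermonde matrix with distinct nodes
  (\<open>det_gram_prime_powers\<close>). Positivity is what covers those \<open>s\<close> for which the powers
  \<open>\<ell>\<^sub>i\<^sup>d\<^sup>-\<^sup>k\<close> are linearly dependent: there the rank of the matrices of values in degrees \<open>k\<close> and \<open>d - k\<close>
  does not determine the rank of their product.\<close>

section \<open>Linear functionals and evaluation of polynomials\<close>

text \<open>A linear functional on polynomials is given by its values \<open>\<phi> m\<close> on the monomials
  \<open>x\<^sup>m\<close>. Evaluation at a point and the apolar functional of a form below are both of this kind,
  which lets them share the rules for sums and products.\<close>

definition lin_ext :: "(('i \<Rightarrow>\<^sub>0 nat) \<Rightarrow> 'k) \<Rightarrow> ('i, 'k::comm_semiring_1) mpoly \<Rightarrow> 'k" where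
  "lin_ext \<phi> p = (\<Sum>m\<in>Poly_Mapping.keys p. Poly_Mapping.lookup p m * \<phi> m)"

lemma poly_eq_sum_single:
  "p = (\<Sum>m\<in>Poly_Mapping.keys p. Poly_Mapping.single m (Poly_Mapping.lookup p m))"
  by (rule poly_mapping_eqI)
    (auto simp: lookup_sum lookup_single when_def in_keys_iff sum.delta)

lemma lin_ext_superset:
  assumes "finite A" "Poly_Mapping.keys p \<subseteq> A"
  shows "lin_ext \<phi> p = (\<Sum>m\<in>A. Poly_Mapping.lookup p m * \<phi> m)"
  unfolding lin_ext_def using assms
  by (intro sum.mono_neutral_left) (auto simp: in_keys_iff)

lemma lin_ext_add: "lin_ext \<phi> (p + q) = lin_ext \<phi> p + lin_ext \<phi> q"
proof -
  let ?A = "Poly_Mapping.keys p \<union> Poly_Mapping.keys q"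
  have "lin_ext \<phi> (p + q) = (\<Sum>m\<in>?A. Poly_Mapping.lookup (p + q) m * \<phi> m)"
    by (rule lin_ext_superset) (use Poly_Mapping.keys_add[of p q] in auto)
  also have "\<dots> = lin_ext \<phi> p + lin_ext \<phi> q"
    by (simp add: lin_ext_superset[of ?A] lookup_add distrib_right sum.distrib)
  finally show ?thesis .
qed

lemma lin_ext_zero [simp]: "lin_ext \<phi> 0 = 0"
  by (simp add: lin_ext_def)

lemma lin_ext_single [simp]: "lin_ext \<phi> (Poly_Mapping.single m c) = c * \<phi> m"
  by (simp add: lin_ext_def)

lemma lin_ext_sum: "lin_ext \<phi> (\<Sum>x\<in>A. f x) = (\<Sum>x\<in>A. lin_ext \<phi> (f x))"
  by (induction A rule: infinite_finite_induct) (auto simp: lin_ext_add)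

lemma lin_ext_uminus: "lin_ext \<phi> (- p) = - lin_ext \<phi> (p :: ('i, 'k::comm_ring_1) mpoly)"
  using lin_ext_add[of \<phi> p "- p"] by (simp add: eq_neg_iff_add_eq_0 add.commute)

lemma lin_ext_diff:
  "lin_ext \<phi> (p - q) = lin_ext \<phi> p - lin_ext \<phi> (q :: ('i, 'k::comm_ring_1) mpoly)"
  using lin_ext_add[of \<phi> p "- q"] by (simp add: lin_ext_uminus)

lemma lin_ext_scale: "lin_ext (\<lambda>m. c * \<phi> m) p = c * lin_ext \<phi> p"
  by (simp add: lin_ext_def sum_distrib_left ac_simps)

lemma lin_ext_scale_right: "lin_ext (\<lambda>m. \<phi> m * c) p = lin_ext \<phi> p * c"
  by (simp add: lin_ext_def sum_distrib_right mult.assoc)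

lemma lin_ext_mult:
  "lin_ext \<phi> (p * q) = lin_ext (\<lambda>m. lin_ext (\<lambda>m'. \<phi> (m + m')) q) p"
proof -
  have single: "lin_ext \<phi> (Poly_Mapping.single m c * q) = c * lin_ext (\<lambda>m'. \<phi> (m + m')) q" for m c
  proof -
    have "Poly_Mapping.single m c * q =
        (\<Sum>m'\<in>Poly_Mapping.keys q. Poly_Mapping.single (m + m') (c * Poly_Mapping.lookup q m'))"
      by (subst (1) poly_eq_sum_single[of q]) (simp add: sum_distrib_left mult_single)
    then show ?thesis
      by (simp add: lin_ext_sum) (simp add: lin_ext_def sum_distrib_left mult.assoc)
  qed
  have "lin_ext \<phi> (p * q) =
      lin_ext \<phi> (\<Sum>m\<in>Poly_Mapping.keys p. Poly_Mapping.single m (Poly_Mapping.lookup p m) * q)"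
    by (subst (1) poly_eq_sum_single[of p]) (simp add: sum_distrib_right)
  also have "\<dots> = lin_ext (\<lambda>m. lin_ext (\<lambda>m'. \<phi> (m + m')) q) p"
    by (simp add: lin_ext_sum single) (simp add: lin_ext_def)
  finally show ?thesis .
qed

lemma lin_ext_const_mult [simp]: "lin_ext \<phi> (const c * p) = c * lin_ext \<phi> p"
  by (simp add: lin_ext_mult const_def)

definition monom_val :: "('i \<Rightarrow> 'k::comm_semiring_1) \<Rightarrow> ('i \<Rightarrow>\<^sub>0 nat) \<Rightarrow> 'k" where
  "monom_val a m = (\<Prod>i\<in>Poly_Mapping.keys m. a i ^ Poly_Mapping.lookup m i)"

lemma eval_at_eq_lin_ext: "eval_at a = lin_ext (monom_val a)"
  by (simp add: eval_at_def lin_ext_def monom_val_def fun_eq_iff)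

lemma monom_val_superset:
  assumes "finite A" "Poly_Mapping.keys m \<subseteq> A"
  shows "monom_val a m = (\<Prod>i\<in>A. a i ^ Poly_Mapping.lookup m i)"
  unfolding monom_val_def using assms
  by (intro prod.mono_neutral_left) (auto simp: in_keys_iff)

lemma monom_val_zero [simp]: "monom_val a 0 = 1"
  by (simp add: monom_val_def)

lemma monom_val_add: "monom_val a (m + m') = monom_val a m * monom_val a m'"
proof -
  let ?A = "Poly_Mapping.keys m \<union> Poly_Mapping.keys m'"
  have "monom_val a (m + m') = (\<Prod>i\<in>?A. a i ^ Poly_Mapping.lookup (m + m') i)"
    by (rule monom_val_superset) (use Poly_Mapping.keys_add[of m m'] in auto)
  also have "\<dots> = monom_val a m * monom_val a m'"
    by (simp add: monom_val_superset[of ?A] lookup_add power_add prod.distrib)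
  finally show ?thesis .
qed

lemma monom_val_single [simp]: "monom_val a (Poly_Mapping.single i k) = a i ^ k"
  by (cases "k = 0") (simp_all add: monom_val_def)

lemma monom_val_cong:
  "(\<And>i. i \<in> Poly_Mapping.keys m \<Longrightarrow> a i = b i) \<Longrightarrow> monom_val a m = monom_val b m"
  by (simp add: monom_val_def)

lemma eval_at_mult: "eval_at a (p * q) = eval_at a p * eval_at a q"
  by (simp add: eval_at_eq_lin_ext lin_ext_mult monom_val_add lin_ext_scale lin_ext_scale_right)

lemma eval_at_one: "eval_at a 1 = 1"
  using lin_ext_single[of "monom_val a" 0 1] by (simp add: eval_at_eq_lin_ext)

lemma eval_at_hom: "comm_ring_hom (eval_at (a :: 'i \<Rightarrow> 'k::comm_ring_1))"
  by unfold_locales (simp_all add: eval_at_mult eval_at_one, simp_all add: eval_at_eq_lin_ext lin_ext_add)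

lemma eval_at_single: "eval_at a (Poly_Mapping.single m c) = c * monom_val a m"
  by (simp add: eval_at_eq_lin_ext)

lemma eval_at_var: "eval_at a (var i) = a i"
  by (simp add: eval_at_single var_def)

section \<open>Polynomial rings and their graded parts\<close>

lemma polys_in_add: "p \<in> polys_in I \<Longrightarrow> q \<in> polys_in I \<Longrightarrow> p + q \<in> polys_in I"
  using Poly_Mapping.keys_add by (fastforce simp: polys_in_def)

lemma polys_in_uminus: "p \<in> polys_in I \<Longrightarrow> - p \<in> polys_in I"
  by (simp add: polys_in_def in_keys_iff)

lemma polys_in_mult:
  assumes "p \<in> polys_in I" "q \<in> polys_in I" shows "p * q \<in> polys_in I"
  unfolding polys_in_def
proof safe
  fix m i assume m: "m \<in> Poly_Mapping.keys (p * q)" and i: "i \<in> Poly_Mapping.keys m"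
  then obtain u v where "u \<in> Poly_Mapping.keys p" "v \<in> Poly_Mapping.keys q" "m = u + v"
    using Poly_Mapping.keys_mult by blast
  with assms i Poly_Mapping.keys_add[of u v] show "i \<in> I" by (fastforce simp: polys_in_def)
qed

lemma polys_in_single: "Poly_Mapping.keys m \<subseteq> I \<Longrightarrow> Poly_Mapping.single m c \<in> polys_in I"
  by (auto simp: polys_in_def)

lemma polys_in_const: "const c \<in> polys_in I"
  by (auto simp: polys_in_def const_def)

lemma polys_in_var: "i \<in> I \<Longrightarrow> var i \<in> polys_in I"
  by (auto simp: polys_in_def var_def)

lemma polys_in_zero: "0 \<in> polys_in I"
  by (simp add: polys_in_def)

lemma polys_in_one: "1 \<in> polys_in I"
  by (simp add: polys_in_def)

lemma polys_in_sum: "(\<And>x. x \<in> A \<Longrightarrow> f x \<in> polys_in I) \<Longrightarrow> sum f A \<in> polys_in I"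
  by (induction A rule: infinite_finite_induct) (auto simp: polys_in_zero polys_in_add)

lemma polys_in_prod: "(\<And>x. x \<in> A \<Longrightarrow> f x \<in> polys_in I) \<Longrightarrow> prod f A \<in> polys_in I"
  by (induction A rule: infinite_finite_induct) (auto simp: polys_in_one polys_in_mult)

lemma polys_in_power: "p \<in> polys_in I \<Longrightarrow> p ^ k \<in> polys_in I"
  by (induction k) (auto simp: polys_in_one polys_in_mult)

text \<open>By the Leibniz formula a determinant is a polynomial in the entries; this is what makes
  the nonvanishing of a minor a Zariski open condition on the coefficients of the linear forms.\<close>

lemma polys_in_det:
  assumes A: "A \<in> carrier_mat r r"
    and entries: "\<And>u v. u < r \<Longrightarrow> v < r \<Longrightarrow> A $$ (u, v) \<in> polys_in I"
  shows "det (A :: ('i, 'k::comm_ring_1) mpoly mat) \<in> polys_in I"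
proof -
  have "signof \<pi> * (\<Prod>i = 0..<r. A $$ (i, \<pi> i)) \<in> polys_in I" if "\<pi> permutes {0..<r}" for \<pi>
    using permutes_in_image[OF that] entries
    by (intro polys_in_mult polys_in_prod) (auto simp: sign_def polys_in_one polys_in_uminus)
  then show ?thesis
    by (subst det_def'[OF A]) (auto intro!: polys_in_sum)
qed

lemma mon_deg_superset:
  assumes "finite A" "Poly_Mapping.keys m \<subseteq> A"
  shows "mon_deg m = (\<Sum>i\<in>A. Poly_Mapping.lookup m i)"
  unfolding mon_deg_def using assms
  by (intro sum.mono_neutral_left) (auto simp: in_keys_iff)

lemma mon_deg_add: "mon_deg (m + m') = mon_deg m + mon_deg m'"
proof -
  let ?A = "Poly_Mapping.keys m \<union> Poly_Mapping.keys m'"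
  have "mon_deg (m + m') = (\<Sum>i\<in>?A. Poly_Mapping.lookup (m + m') i)"
    by (rule mon_deg_superset) (use Poly_Mapping.keys_add[of m m'] in auto)
  also have "\<dots> = mon_deg m + mon_deg m'"
    by (simp add: mon_deg_superset[of ?A] lookup_add sum.distrib)
  finally show ?thesis .
qed

lemma mon_deg_single [simp]: "mon_deg (Poly_Mapping.single i k) = k"
  by (cases "k = 0") (simp_all add: mon_deg_def)

lemma mon_deg_zero [simp]: "mon_deg 0 = 0"
  by (simp add: mon_deg_def)

lemma graded_part_add: "p \<in> graded_part I k \<Longrightarrow> q \<in> graded_part I k \<Longrightarrow> p + q \<in> graded_part I k"
  using Poly_Mapping.keys_add[of p q] by (fastforce simp: graded_part_def polys_in_add)

lemma graded_part_mult:
  assumes "p \<in> graded_part I k" "q \<in> graded_part I l" shows "p * q \<in> graded_part I (k + l)"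
  using assms polys_in_mult[of p I q] Poly_Mapping.keys_mult[of p q]
  by (fastforce simp: graded_part_def mon_deg_add)

lemma graded_part_const: "const c \<in> graded_part I 0"
  by (auto simp: graded_part_def polys_in_const) (auto simp: const_def split: if_splits)

lemma graded_part_const_mult: "p \<in> graded_part I k \<Longrightarrow> const c * p \<in> graded_part I k"
  using graded_part_mult[OF graded_part_const, of p I k c] by simp

lemma graded_part_zero: "0 \<in> graded_part I k"
  by (simp add: graded_part_def polys_in_zero)

lemma graded_part_sum:
  "(\<And>x. x \<in> A \<Longrightarrow> f x \<in> graded_part I k) \<Longrightarrow> sum f A \<in> graded_part I k"
  by (induction A rule: infinite_finite_induct) (auto simp: graded_part_zero graded_part_add)

lemma graded_part_uminus: "p \<in> graded_part I k \<Longrightarrow> - p \<in> graded_part I k"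
  by (simp add: graded_part_def polys_in_uminus in_keys_iff)

lemma graded_part_diff:
  "p \<in> graded_part I k \<Longrightarrow> q \<in> graded_part I k \<Longrightarrow> p - q \<in> graded_part I k"
  for p q :: "('i, 'k::comm_ring_1) mpoly"
  using graded_part_add[of p I k "- q"] by (simp add: graded_part_uminus)

lemma graded_part_single:
  "Poly_Mapping.keys m \<subseteq> I \<Longrightarrow> mon_deg m = k \<Longrightarrow> Poly_Mapping.single m c \<in> graded_part I k"
  by (auto simp: graded_part_def polys_in_single split: if_splits)

section \<open>The apolar pairing\<close>

definition mon_fact :: "('i \<Rightarrow>\<^sub>0 nat) \<Rightarrow> 'k::field_char_0" where
  "mon_fact m = (\<Prod>i\<in>Poly_Mapping.keys m. fact (Poly_Mapping.lookup m i))"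

text \<open>The coefficients of \<open>F\<close> in the basis of divided powers \<open>X\<^sup>m / m!\<close>. In this
  basis differentiation is a mere shift of exponents, so the factors produced by the product rule
  disappear from all later computations.\<close>

definition dp_coeff :: "('i, 'k::field_char_0) mpoly \<Rightarrow> ('i \<Rightarrow>\<^sub>0 nat) \<Rightarrow> 'k" where
  "dp_coeff F m = mon_fact m * Poly_Mapping.lookup F m"

text \<open>Differentiating \<open>F\<close> by \<open>p\<close> and then setting the variables to zero.\<close>

definition apolar :: "('i, 'k::field_char_0) mpoly \<Rightarrow> ('i, 'k) mpoly \<Rightarrow> 'k" where
  "apolar F = lin_ext (dp_coeff F)"

lemma mon_fact_nonzero: "mon_fact m \<noteq> (0 :: 'k::field_char_0)"
  by (simp add: mon_fact_def)

lemma mon_fact_add_single: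
  "mon_fact (m + Poly_Mapping.single i 1) =
    (of_nat (Suc (Poly_Mapping.lookup m i)) * mon_fact m :: 'k::field_char_0)"
proof -
  let ?A = "insert i (Poly_Mapping.keys m)"
  have superset: "mon_fact m' = (\<Prod>j\<in>?A. fact (Poly_Mapping.lookup m' j) :: 'k)"
    if "Poly_Mapping.keys m' \<subseteq> ?A" for m'
    unfolding mon_fact_def using that
    by (intro prod.mono_neutral_left) (auto simp: in_keys_iff)
  have keys: "Poly_Mapping.keys (m + Poly_Mapping.single i 1) \<subseteq> ?A"
    using Poly_Mapping.keys_add[of m "Poly_Mapping.single i 1"] by auto
  have "mon_fact (m + Poly_Mapping.single i 1) =
      (\<Prod>j\<in>?A. (if j = i then of_nat (Suc (Poly_Mapping.lookup m i)) else 1) *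
        fact (Poly_Mapping.lookup m j) :: 'k)"
    unfolding superset[OF keys]
    by (intro prod.cong) (auto simp: lookup_add lookup_single when_def)
  also have "\<dots> = of_nat (Suc (Poly_Mapping.lookup m i)) * mon_fact m"
    by (simp add: superset[of m] prod.distrib subset_insertI del: of_nat_Suc prod.insert_remove)
  finally show ?thesis .
qed

lemma lookup_const_mult: "Poly_Mapping.lookup (const c * F) m = c * Poly_Mapping.lookup F m"
  unfolding const_def mult_map_scale_conv_mult[symmetric]
  by (simp add: map.rep_eq when_def)

lemma dp_coeff_sum: "dp_coeff (\<Sum>x\<in>A. f x) m = (\<Sum>x\<in>A. dp_coeff (f x) m)"
  by (simp add: dp_coeff_def lookup_sum sum_distrib_left)

lemma dp_coeff_const_mult: "dp_coeff (const c * F) m = c * dp_coeff F m"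
  by (simp add: dp_coeff_def lookup_const_mult)

lemma lookup_partial_deriv:
  "Poly_Mapping.lookup (partial_deriv i F) m =
    of_nat (Suc (Poly_Mapping.lookup m i)) * Poly_Mapping.lookup F (m + Poly_Mapping.single i 1)"
proof -
  let ?e = "Poly_Mapping.single i (1::nat)"
  have eq: "Poly_Mapping.lookup (Poly_Mapping.single (m' - ?e)
        (of_nat (Poly_Mapping.lookup m' i) * Poly_Mapping.lookup F m')) m =
      (if m' = m + ?e then of_nat (Poly_Mapping.lookup m' i) * Poly_Mapping.lookup F m' else 0)" for m'
  proof (cases "Poly_Mapping.lookup m' i = 0")
    case False
    then have "m' - ?e + ?e = m'"
      by (intro poly_mapping_eqI) (auto simp: lookup_add lookup_minus lookup_single when_def)
    then have "m' - ?e = m \<longleftrightarrow> m' = m + ?e" by auto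
    then show ?thesis by (simp add: lookup_single when_def)
  qed (auto simp: lookup_add)
  have "Poly_Mapping.lookup (partial_deriv i F) m = (\<Sum>m'\<in>Poly_Mapping.keys F.
      if m' = m + ?e then of_nat (Poly_Mapping.lookup m' i) * Poly_Mapping.lookup F m' else 0)"
    unfolding partial_deriv_def lookup_sum eq ..
  then show ?thesis
    by (simp add: sum.delta in_keys_iff lookup_add)
qed

lemma dp_coeff_partial_deriv: "dp_coeff (partial_deriv i F) m = dp_coeff F (m + Poly_Mapping.single i 1)"
  unfolding dp_coeff_def lookup_partial_deriv mon_fact_add_single by simp

lemma dp_coeff_partial_deriv_funpow:
  "dp_coeff ((partial_deriv i ^^ k) F) m = dp_coeff F (m + Poly_Mapping.single i k)"
proof (induction k arbitrary: m)
  case (Suc k)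
  have "Poly_Mapping.single i (Suc k) = Poly_Mapping.single i 1 + Poly_Mapping.single i k"
    by (metis plus_1_eq_Suc single_add)
  then show ?case by (simp add: dp_coeff_partial_deriv Suc.IH add.assoc)
qed simp

lemma dp_coeff_monom_deriv:
  assumes "Poly_Mapping.keys m \<subseteq> {..<n}"
  shows "dp_coeff (monom_deriv n m F) m' = dp_coeff F (m + m')"
proof -
  have "dp_coeff (foldr (\<lambda>i. partial_deriv i ^^ Poly_Mapping.lookup m i) is F) m' =
      dp_coeff F ((\<Sum>i\<leftarrow>is. Poly_Mapping.single i (Poly_Mapping.lookup m i)) + m')" for "is"
    by (induction "is" arbitrary: m') (simp_all add: dp_coeff_partial_deriv_funpow ac_simps)
  moreover have "(\<Sum>i\<leftarrow>[0..<n]. Poly_Mapping.single i (Poly_Mapping.lookup m i)) = m"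
  proof (rule poly_mapping_eqI)
    fix i
    have "i < n \<or> Poly_Mapping.lookup m i = 0"
      using assms by (meson lessThan_iff not_in_keys_iff_lookup_eq_zero subsetD)
    then show "Poly_Mapping.lookup (\<Sum>i\<leftarrow>[0..<n]. Poly_Mapping.single i (Poly_Mapping.lookup m i)) i
        = Poly_Mapping.lookup m i"
      by (auto simp: interv_sum_list_conv_sum_set_nat lookup_sum lookup_single when_def)
  qed
  ultimately show ?thesis by (simp add: monom_deriv_def)
qed

lemma dp_coeff_diff_action:
  assumes "p \<in> polys_in {..<n}"
  shows "dp_coeff (diff_action n p F) m' = lin_ext (\<lambda>m. dp_coeff F (m + m')) p"
proof -
  have "dp_coeff (diff_action n p F) m' =
      (\<Sum>m\<in>Poly_Mapping.keys p. Poly_Mapping.lookup p m * dp_coeff (monom_deriv n m F) m')"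
    by (simp add: diff_action_def dp_coeff_sum dp_coeff_const_mult)
  then show ?thesis
    using assms by (simp add: lin_ext_def polys_in_def dp_coeff_monom_deriv)
qed

lemma dp_coeff_eq_zero_iff: "(\<forall>m. dp_coeff F m = 0) \<longleftrightarrow> F = 0"
  by (auto simp: dp_coeff_def mon_fact_nonzero intro: poly_mapping_eqI)

lemma apolar_single_mult:
  "apolar F (p * Poly_Mapping.single m' c) = c * lin_ext (\<lambda>m. dp_coeff F (m + m')) p"
  unfolding apolar_def lin_ext_mult by (simp add: lin_ext_def sum_distrib_left ac_simps)

lemma mem_Ann_iff_monomials:
  assumes "p \<in> polys_in {..<n}"
  shows "p \<in> Ann n F \<longleftrightarrow> (\<forall>m'. apolar F (p * Poly_Mapping.single m' 1) = 0)"
  by (simp add: Ann_def assms dp_coeff_eq_zero_iff[of "diff_action n p F", symmetric]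
      dp_coeff_diff_action apolar_single_mult)

text \<open>The annihilator is the kernel of the symmetric form \<open>(p, q) \<mapsto> apolar F (p * q)\<close>,
  because \<open>apolar F (p * x\<^sup>m)\<close> is the divided power coefficient of \<open>p \<circ> F\<close> at \<open>m\<close>. In this form it
  is visibly an ideal.\<close>

lemma mem_Ann_iff: "p \<in> Ann n F \<longleftrightarrow> p \<in> polys_in {..<n} \<and> (\<forall>q. apolar F (p * q) = 0)"
proof (cases "p \<in> polys_in {..<n}")
  case True
  have "apolar F (p * q) = 0" if "\<forall>m'. apolar F (p * Poly_Mapping.single m' 1) = 0" for q
  proof -
    have "p * q = (\<Sum>m'\<in>Poly_Mapping.keys q. p * Poly_Mapping.single m' (Poly_Mapping.lookup q m'))"
      by (subst (1) poly_eq_sum_single[of q]) (simp add: sum_distrib_left)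
    moreover have "apolar F (p * Poly_Mapping.single m' c) = 0" for m' c
      using that by (simp add: apolar_single_mult)
    ultimately show ?thesis by (simp add: apolar_def lin_ext_sum)
  qed
  then show ?thesis using True mem_Ann_iff_monomials[OF True] by blast
qed (simp add: Ann_def)

text \<open>For a form \<open>F\<close> of degree \<open>d\<close> the functional sees only degree \<open>d\<close>, so an element of
  degree \<open>k\<close> has to be tested only against degree \<open>d - k\<close>. Hence the degree \<open>k\<close> part of the algebra
  is the quotient of the left side of a pairing of two finite-dimensional spaces by its kernel.\<close>

lemma graded_mem_Ann_iff:
  assumes F: "F \<in> graded_part {..<n} d" and p: "p \<in> graded_part {..<n} k" and "k \<le> d"
  shows "p \<in> Ann n F \<longleftrightarrow> (\<forall>q \<in> graded_part {..<n} (d - k). apolar F (p * q) = 0)"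
proof
  assume perp: "\<forall>q \<in> graded_part {..<n} (d - k). apolar F (p * q) = 0"
  have "apolar F (p * Poly_Mapping.single m' 1) = 0" for m'
  proof (cases "Poly_Mapping.keys m' \<subseteq> {..<n} \<and> mon_deg m' = d - k")
    case True
    then show ?thesis using perp by (simp add: graded_part_single)
  next
    case False
    have "dp_coeff F (m + m') = 0" if m: "m \<in> Poly_Mapping.keys p" for m
    proof (rule ccontr)
      assume "dp_coeff F (m + m') \<noteq> 0"
      then have "m + m' \<in> Poly_Mapping.keys F" by (auto simp: dp_coeff_def in_keys_iff)
      then have "mon_deg (m + m') = d" "Poly_Mapping.keys (m + m') \<subseteq> {..<n}"
        using F by (auto simp: graded_part_def polys_in_def)
      moreover have "mon_deg m = k" using m p by (simp add: graded_part_def)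
      moreover have "Poly_Mapping.keys m' \<subseteq> Poly_Mapping.keys (m + m')"
        by (auto simp: in_keys_iff lookup_add)
      ultimately show False using False by (auto simp: mon_deg_add)
    qed
    then show ?thesis by (simp add: apolar_single_mult lin_ext_def)
  qed
  then show "p \<in> Ann n F"
    using p mem_Ann_iff_monomials[of p n F] by (simp add: graded_part_def)
qed (simp add: mem_Ann_iff)

lemma lookup_var_mult:
  "Poly_Mapping.lookup (var j * F) m = (if Poly_Mapping.lookup m j = 0 then 0
     else Poly_Mapping.lookup F (m - Poly_Mapping.single j 1))"
  for F :: "('i, 'k::comm_semiring_1) mpoly"
proof -
  let ?e = "Poly_Mapping.single j (1::nat)"
  have eq: "?e + m' = m \<longleftrightarrow> Poly_Mapping.lookup m j \<noteq> 0 \<and> m' = m - ?e" for m'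
  proof
    assume "?e + m' = m"
    then show "Poly_Mapping.lookup m j \<noteq> 0 \<and> m' = m - ?e" by (auto simp: lookup_add)
  next
    assume "Poly_Mapping.lookup m j \<noteq> 0 \<and> m' = m - ?e"
    then show "?e + m' = m"
      by (intro poly_mapping_eqI) (auto simp: lookup_add lookup_minus lookup_single when_def)
  qed
  have "var j * F = (\<Sum>m'\<in>Poly_Mapping.keys F. Poly_Mapping.single (?e + m') (Poly_Mapping.lookup F m'))"
    by (subst (1) poly_eq_sum_single[of F]) (simp add: sum_distrib_left mult_single var_def)
  then have "Poly_Mapping.lookup (var j * F) m = (\<Sum>m'\<in>Poly_Mapping.keys F.
      if Poly_Mapping.lookup m j \<noteq> 0 \<and> m' = m - ?e then Poly_Mapping.lookup F m' else 0)"
    by (simp add: lookup_sum lookup_single when_def eq[unfolded One_nat_def])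
  then show ?thesis by (auto simp: sum.delta in_keys_iff)
qed

lemma dp_coeff_var_mult:
  "dp_coeff (var j * F) m =
    of_nat (Poly_Mapping.lookup m j) * dp_coeff F (m - Poly_Mapping.single j 1)"
proof (cases "Poly_Mapping.lookup m j = 0")
  case False
  define m' where "m' = m - Poly_Mapping.single j 1"
  have "m = m' + Poly_Mapping.single j 1" unfolding m'_def using False
    by (intro poly_mapping_eqI) (auto simp: lookup_add lookup_minus lookup_single when_def)
  then show ?thesis
    unfolding dp_coeff_def lookup_var_mult by (simp add: mon_fact_add_single[unfolded One_nat_def] lookup_add del: of_nat_Suc)
qed (simp add: dp_coeff_def lookup_var_mult)

text \<open>The multinomial theorem: in divided powers, \<open>\<ell>\<^sup>d = d! \<Sum> a\<^sup>m X\<^sup>m / m!\<close> over the exponents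
  of degree \<open>d\<close>. Extending the coefficient vector of \<open>\<ell>\<close> by zero makes the formula valid for
  exponents that involve variables beyond the first \<open>n\<close> as well.\<close>

lemma dp_coeff_linear_form_power:
  "dp_coeff (linear_form n a i ^ d) m =
    (if mon_deg m = d then fact d * monom_val (\<lambda>j. if j < n then a (i, j) else 0) m else 0)"
proof (induction d arbitrary: m)
  case 0
  have "mon_deg m = 0 \<longleftrightarrow> m = 0"
    by (auto simp: mon_deg_def in_keys_iff intro: poly_mapping_eqI)
  then show ?case by (simp add: dp_coeff_def lookup_one when_def mon_fact_def)
next
  case (Suc d)
  let ?c = "\<lambda>j. if j < n then a (i, j) else 0"
  let ?e = "\<lambda>j. Poly_Mapping.single j (1::nat)"
  have "dp_coeff (linear_form n a i ^ Suc d) m =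
      (\<Sum>j<n. a (i, j) * dp_coeff (var j * linear_form n a i ^ d) m)"
    by (subst power_Suc, subst (1) linear_form_def)
      (simp add: sum_distrib_right mult.assoc dp_coeff_sum dp_coeff_const_mult)
  \<comment> \<open>The term of \<open>X\<^sub>j\<close> contributes the share \<open>m\<^sub>j\<close> of the degree \<open>Suc d\<close> that completes \<open>d!\<close>.\<close>
  also have "\<dots> = (\<Sum>j<n. of_nat (Poly_Mapping.lookup m j) *
      (if mon_deg m = Suc d then fact d * monom_val ?c m else 0))"
  proof (rule sum.cong)
    fix j assume j: "j \<in> {..<n}"
    show "a (i, j) * dp_coeff (var j * linear_form n a i ^ d) m = of_nat (Poly_Mapping.lookup m j) *
      (if mon_deg m = Suc d then fact d * monom_val ?c m else 0)"
    proof (cases "Poly_Mapping.lookup m j = 0")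
      case False
      define m' where "m' = m - ?e j"
      have m: "m = m' + ?e j" unfolding m'_def using False
        by (intro poly_mapping_eqI) (auto simp: lookup_add lookup_minus lookup_single when_def)
      have val: "monom_val ?c m = monom_val ?c m' * a (i, j)"
        unfolding m monom_val_add using j by simp
      have deg: "mon_deg m = Suc (mon_deg m')"
        unfolding m by (simp add: mon_deg_add)
      show ?thesis
        unfolding dp_coeff_var_mult Suc.IH m'_def[symmetric] val deg by simp
    qed (simp add: dp_coeff_var_mult)
  qed simp
  also have "\<dots> = of_nat (\<Sum>j<n. Poly_Mapping.lookup m j) *
      (if mon_deg m = Suc d then fact d * monom_val ?c m else 0)"
    by (simp add: sum_distrib_right)
  also have "\<dots> = (if mon_deg m = Suc d then fact (Suc d) * monom_val ?c m else 0)"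
  proof (cases "Poly_Mapping.keys m \<subseteq> {..<n}")
    case True
    then show ?thesis by (simp add: mon_deg_superset[of "{..<n}", symmetric] ac_simps)
  next
    case False
    then obtain j where "j \<in> Poly_Mapping.keys m" "\<not> j < n" by auto
    then have "monom_val ?c m = 0"
      by (auto simp: monom_val_def in_keys_iff intro!: prod_zero bexI[of _ j])
    then show ?thesis by simp
  qed
  finally show ?case .
qed

text \<open>Differentiating \<open>\<ell>\<^sup>d\<close> by a form of degree \<open>d\<close> is, up to \<open>d!\<close>, evaluation at the
  coefficient vector of \<open>\<ell>\<close>. This turns statements on \<open>F\<^sub>s\<close> into statements on \<open>s\<close> points.\<close>

lemma apolar_power_sum:
  assumes "p \<in> graded_part {..<n} d"
  shows "apolar (power_sum n d s a) p = fact d * (\<Sum>i<s. eval_at (\<lambda>j. a (i, j)) p)"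
proof -
  have "dp_coeff (power_sum n d s a) m = fact d * (\<Sum>i<s. monom_val (\<lambda>j. a (i, j)) m)"
    if m: "m \<in> Poly_Mapping.keys p" for m
  proof -
    have "mon_deg m = d" "Poly_Mapping.keys m \<subseteq> {..<n}"
      using m assms by (auto simp: graded_part_def polys_in_def)
    moreover have "dp_coeff (power_sum n d s a) m = (\<Sum>i<s. dp_coeff (linear_form n a i ^ d) m)"
      by (simp add: power_sum_def dp_coeff_sum)
    moreover from \<open>Poly_Mapping.keys m \<subseteq> {..<n}\<close>
    have "monom_val (\<lambda>j. if j < n then a (i, j) else 0) m = monom_val (\<lambda>j. a (i, j)) m" for i
      by (intro monom_val_cong) auto
    ultimately show ?thesis by (simp add: dp_coeff_linear_form_power sum_distrib_left)
  qed
  then have "apolar (power_sum n d s a) p = (\<Sum>m\<in>Poly_Mapping.keys p. \<Sum>i<s.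
      fact d * (Poly_Mapping.lookup p m * monom_val (\<lambda>j. a (i, j)) m))"
    by (simp add: apolar_def lin_ext_def sum_distrib_left ac_simps)
  also have "\<dots> = fact d * (\<Sum>i<s. eval_at (\<lambda>j. a (i, j)) p)"
    by (subst sum.swap) (simp add: eval_at_eq_lin_ext lin_ext_def sum_distrib_left)
  finally show ?thesis .
qed

lemma power_sum_graded: "power_sum n d s a \<in> graded_part {..<n} d"
  for a :: "nat \<times> nat \<Rightarrow> 'k::comm_ring_1"
proof -
  have "linear_form n a i \<in> graded_part {..<n} 1" for i
    unfolding linear_form_def var_def
    by (intro graded_part_sum graded_part_const_mult graded_part_single) auto
  then have "linear_form n a i ^ d \<in> graded_part {..<n} d" for i
  proof (induction d)
    case 0
    show ?case using graded_part_const[of "1 :: 'k" "{..<n}"] by (simp add: const_def)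
  next
    case (Suc d)
    then show ?case using graded_part_mult[of "linear_form n a i" "{..<n}" 1 "linear_form n a i ^ d" d] by simp
  qed
  then show ?thesis unfolding power_sum_def by (intro graded_part_sum)
qed

section \<open>The Hilbert function as the rank of a pairing\<close>

lemma poly_ring_simps [simp]:
  "carrier (poly_ring n) = polys_in {..<n}" "p \<otimes>\<^bsub>poly_ring n\<^esub> q = p * q" "\<one>\<^bsub>poly_ring n\<^esub> = 1"
  "p \<oplus>\<^bsub>poly_ring n\<^esub> q = p + q" "\<zero>\<^bsub>poly_ring n\<^esub> = 0"
  by (simp_all add: poly_ring_def)

lemma poly_ring_cring: "cring (poly_ring n :: (nat, 'k::comm_ring_1) mpoly ring)"
proof (rule cringI)
  show "abelian_group (poly_ring n :: (nat, 'k) mpoly ring)"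
  proof (rule abelian_groupI)
    fix p :: "(nat, 'k) mpoly" assume "p \<in> carrier (poly_ring n)"
    then show "\<exists>q\<in>carrier (poly_ring n). q \<oplus>\<^bsub>poly_ring n\<^esub> p = \<zero>\<^bsub>poly_ring n\<^esub>"
      by (intro bexI[of _ "- p"]) (simp_all add: polys_in_uminus)
  qed (simp_all add: polys_in_add polys_in_zero ac_simps)
  show "Group.comm_monoid (poly_ring n :: (nat, 'k) mpoly ring)"
    by (rule comm_monoidI) (simp_all add: polys_in_mult polys_in_one ac_simps)
qed (simp add: distrib_right)

lemma poly_ring_a_inv:
  assumes "p \<in> polys_in {..<n}"
  shows "\<ominus>\<^bsub>poly_ring n\<^esub> p = (- p :: (nat, 'k::comm_ring_1) mpoly)"
proof -
  interpret cring "poly_ring n :: (nat, 'k) mpoly ring" by (rule poly_ring_cring)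
  show ?thesis using assms by (intro minus_equality) (simp_all add: polys_in_uminus)
qed

lemma Ann_ideal: "ideal (Ann n F) (poly_ring n)"
  for F :: "(nat, 'k::field_char_0) mpoly"
proof (rule idealI)
  interpret cring "poly_ring n :: (nat, 'k) mpoly ring" by (rule poly_ring_cring)
  show "ring (poly_ring n :: (nat, 'k) mpoly ring)" by (rule ring_axioms)
  show "subgroup (Ann n F) (add_monoid (poly_ring n))"
  proof (rule add.subgroupI)
    have "0 \<in> Ann n F" by (simp add: mem_Ann_iff polys_in_zero apolar_def)
    then show "Ann n F \<noteq> {}" by blast
    show "\<ominus>\<^bsub>poly_ring n\<^esub> p \<in> Ann n F" if "p \<in> Ann n F" for p
      using that by (simp add: mem_Ann_iff poly_ring_a_inv polys_in_uminus apolar_def lin_ext_uminus)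
  qed (auto simp: mem_Ann_iff polys_in_add distrib_right apolar_def lin_ext_add)
  fix p x :: "(nat, 'k) mpoly" assume "p \<in> Ann n F" "x \<in> carrier (poly_ring n)"
  then have "p * x \<in> Ann n F" by (simp add: mem_Ann_iff polys_in_mult mult.assoc)
  then show "x \<otimes>\<^bsub>poly_ring n\<^esub> p \<in> Ann n F" "p \<otimes>\<^bsub>poly_ring n\<^esub> x \<in> Ann n F"
    by (simp_all add: mult.commute)
qed

lemma Ann_coset_eq_iff:
  fixes F :: "(nat, 'k::field_char_0) mpoly"
  assumes "p \<in> polys_in {..<n}" "q \<in> polys_in {..<n}"
  shows "Ann n F +>\<^bsub>poly_ring n\<^esub> p = Ann n F +>\<^bsub>poly_ring n\<^esub> q \<longleftrightarrow> p - q \<in> Ann n F"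
proof -
  interpret cring "poly_ring n :: (nat, 'k) mpoly ring" by (rule poly_ring_cring)
  interpret ideal "Ann n F" "poly_ring n" by (rule Ann_ideal)
  have "p \<ominus>\<^bsub>poly_ring n\<^esub> q = p - q"
    using assms by (simp add: a_minus_def poly_ring_a_inv)
  with assms show ?thesis
    using quotient_eq_iff_same_a_r_cos[OF Ann_ideal, of p q F] by simp
qed

lemma one_notin_Ann: "F \<noteq> 0 \<Longrightarrow> 1 \<notin> Ann n F"
  for F :: "(nat, 'k::field_char_0) mpoly"
proof
  assume F: "F \<noteq> 0" and one: "1 \<in> Ann n F"
  have "dp_coeff F m = 0" for m
  proof -
    have "apolar F (1 * Poly_Mapping.single m 1) = 0" using one unfolding mem_Ann_iff by blast
    then show ?thesis by (simp add: apolar_def)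
  qed
  with F dp_coeff_eq_zero_iff show False by blast
qed

lemma const_arith:
  "const 0 = 0" "const 1 = 1" "const (a + b) = const a + const b" "const (a * b) = const a * const b"
  for a b :: "'k::comm_ring_1"
  by (simp_all add: const_def single_add mult_single)

text \<open>The classes of the constants are the image of a copy of the field under the quotient
  homomorphism, which does not collapse it because \<open>1\<close> does not annihilate a nonzero \<open>F\<close>.\<close>

lemma scalars_subfield:
  fixes F :: "(nat, 'k::field_char_0) mpoly"
  assumes "F \<noteq> 0"
  shows "subfield (scalars n F) (dual_algebra n F)"
proof -
  interpret R: cring "poly_ring n :: (nat, 'k) mpoly ring" by (rule poly_ring_cring)
  interpret I: ideal "Ann n F" "poly_ring n" by (rule Ann_ideal)
  interpret h: ring_hom_ring "poly_ring n" "poly_ring n Quot Ann n F" "(+>\<^bsub>poly_ring n\<^esub>) (Ann n F)"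
    by (rule I.rcos_ring_hom_ring)
  let ?K = "range (const :: 'k \<Rightarrow> (nat, 'k) mpoly)"
  have minus: "- const c = const (- c)" for c :: 'k
    by (simp add: const_def single_uminus)
  have sub: "subring ?K (poly_ring n)"
  proof (rule R.subringI)
    show "\<one>\<^bsub>poly_ring n\<^esub> \<in> ?K" unfolding poly_ring_simps const_arith(2)[symmetric] by (rule rangeI)
    fix x y assume "x \<in> ?K" "y \<in> ?K"
    then obtain b c where "x = const b" "y = const c" by blast
    then have "x \<in> polys_in {..<n}" "- x = const (- b)" "x * y = const (b * c)" "x + y = const (b + c)"
      by (simp_all add: polys_in_const minus const_arith)
    then show "\<ominus>\<^bsub>poly_ring n\<^esub> x \<in> ?K" "x \<otimes>\<^bsub>poly_ring n\<^esub> y \<in> ?K" "x \<oplus>\<^bsub>poly_ring n\<^esub> y \<in> ?K"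
      by (simp_all add: poly_ring_a_inv)
  qed (auto simp: polys_in_const)
  have "subfield ?K (poly_ring n)"
  proof (rule R.subfieldI)
    show "subcring ?K (poly_ring n)"
      by (rule R.subcringI[OF sub]) (auto simp: mult.commute)
    have "const c \<in> Units (poly_ring n\<lparr>carrier := ?K\<rparr>)" if "c \<noteq> 0" for c :: 'k
    proof -
      have "const (inverse c) * const c = 1" "const c * const (inverse c) = 1"
        using that by (simp_all add: const_arith(2) const_arith(4)[symmetric])
      then show ?thesis by (auto simp: Units_def)
    qed
    moreover have "0 \<notin> Units (poly_ring n\<lparr>carrier := ?K\<rparr>)"
      by (auto simp: Units_def)
    moreover have "Units (poly_ring n\<lparr>carrier := ?K\<rparr>) \<subseteq> ?K"
      by (auto simp: Units_def)
    moreover have "c \<noteq> 0" if "const c \<noteq> (0 :: (nat, 'k) mpoly)" for c :: 'k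
      using that by (auto simp: const_arith)
    ultimately have "Units (poly_ring n\<lparr>carrier := ?K\<rparr>) = ?K - {0}" by blast
    then show "Units (poly_ring n\<lparr>carrier := ?K\<rparr>) = ?K - {\<zero>\<^bsub>poly_ring n\<^esub>}" by simp
  qed
  moreover have "\<one>\<^bsub>poly_ring n Quot Ann n F\<^esub> \<noteq> \<zero>\<^bsub>poly_ring n Quot Ann n F\<^esub>"
    using one_notin_Ann[OF assms, of n] Ann_coset_eq_iff[of 1 n 0 F] h.hom_one h.hom_zero
    by (simp add: polys_in_one polys_in_zero)
  ultimately have "subfield ((+>\<^bsub>poly_ring n\<^esub>) (Ann n F) ` ?K) (poly_ring n Quot Ann n F)"
    by (rule h.img_is_subfield)
  then show ?thesis by (simp add: scalars_def dual_algebra_def image_image)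
qed

text \<open>A dual system exhibits \<open>r\<close> as a lower bound of the rank of the pairing
  \<open>(p, q) \<mapsto> apolar F (p * q)\<close> between degrees \<open>k\<close> and \<open>l\<close>, by forms on which its matrix is the
  identity. Its definition is symmetric in the two degrees, so working with dual systems gives the
  equality of row and column rank for free.\<close>

definition dual_system :: "nat \<Rightarrow> (nat, 'k::field_char_0) mpoly \<Rightarrow> nat \<Rightarrow> nat \<Rightarrow>
    (nat \<Rightarrow> (nat, 'k) mpoly) \<Rightarrow> (nat \<Rightarrow> (nat, 'k) mpoly) \<Rightarrow> nat \<Rightarrow> bool" where
  "dual_system n F k l p q r \<longleftrightarrow>
     (\<forall>u<r. p u \<in> graded_part {..<n} k \<and> q u \<in> graded_part {..<n} l) \<and>
     (\<forall>u<r. \<forall>v<r. apolar F (p u * q v) = (if u = v then 1 else 0))"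

lemma dual_system_sym: "dual_system n F k l p q r \<Longrightarrow> dual_system n F l k q p r"
  by (simp add: dual_system_def mult.commute)

lemma apolar_const_mult: "apolar F (const c * p) = c * apolar F p"
  by (simp add: apolar_def)

lemma apolar_sum: "apolar F (\<Sum>x\<in>A. f x) = (\<Sum>x\<in>A. apolar F (f x))"
  by (simp add: apolar_def lin_ext_sum)

lemma apolar_diff: "apolar F (p - q) = apolar F p - apolar F q"
  by (simp add: apolar_def lin_ext_diff)

lemma apolar_combination:
  assumes "dual_system n F k l p q r" "v < r" "r' \<le> r"
  shows "apolar F ((\<Sum>u<r'. const (c u) * p u) * q v) = (if v < r' then c v else 0)"
proof -
  have "apolar F ((\<Sum>u<r'. const (c u) * p u) * q v) = (\<Sum>u<r'. c u * apolar F (p u * q v))"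
    by (simp add: sum_distrib_right apolar_sum apolar_const_mult mult.assoc)
  also have "\<dots> = (\<Sum>u<r'. if u = v then c v else 0)"
  proof (rule sum.cong)
    fix u assume "u \<in> {..<r'}"
    then have "u < r" using assms(3) by simp
    then have "apolar F (p u * q v) = (if u = v then 1 else 0)"
      using assms(1,2) unfolding dual_system_def by blast
    then show "c u * apolar F (p u * q v) = (if u = v then c v else 0)" by simp
  qed simp
  finally show ?thesis by simp
qed

text \<open>Gram-Schmidt: if \<open>x\<close> is orthogonal to all \<open>q v\<close> but not to \<open>y\<close>, remove from \<open>y\<close> its
  components along the \<open>q u\<close>, which makes it orthogonal to the \<open>p u\<close>, and rescale.\<close>

lemma dual_system_extend:
  assumes sys: "dual_system n F k l p q r"
    and x: "x \<in> graded_part {..<n} k" "\<And>v. v < r \<Longrightarrow> apolar F (x * q v) = 0"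
    and y: "y \<in> graded_part {..<n} l" "apolar F (x * y) \<noteq> 0"
  shows "\<exists>p' q'. dual_system n F k l p' q' (Suc r)"
proof -
  define y' where "y' = y - (\<Sum>u<r. const (apolar F (p u * y)) * q u)"
  define q' where "q' = const (inverse (apolar F (x * y))) * y'"
  have "apolar F (p v * y') = 0" if "v < r" for v
    using apolar_combination[OF dual_system_sym[OF sys] that order.refl, of "\<lambda>u. apolar F (p u * y)"] that
    by (simp add: y'_def right_diff_distrib apolar_diff mult.commute[of "p v"])
  then have pq': "apolar F (p v * q') = 0" if "v < r" for v
    using that by (simp add: q'_def apolar_const_mult mult.left_commute[of "p v"])
  have "apolar F (x * (\<Sum>u<r. const (apolar F (p u * y)) * q u)) = 0"
    by (simp add: sum_distrib_left apolar_sum apolar_const_mult mult.left_commute[of x] x)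
  then have xq': "apolar F (x * q') = 1"
    using y(2) by (simp add: q'_def apolar_const_mult mult.left_commute[of x] y'_def
        right_diff_distrib apolar_diff)
  have "q' \<in> graded_part {..<n} l"
    unfolding q'_def y'_def using sys y(1)
    by (intro graded_part_const_mult graded_part_diff graded_part_sum) (auto simp: dual_system_def)
  then have "dual_system n F k l (p(r := x)) (q(r := q')) (Suc r)"
    using sys x xq' pq' by (auto simp: dual_system_def less_Suc_eq)
  then show ?thesis by blast
qed

text \<open>The first members \<open>p u\<close> of a maximal dual system represent a basis: pairing with the
  \<open>q u\<close> shows that they are independent modulo the annihilator, and by maximality every \<open>x\<close> differs
  from the combination with coefficients \<open>apolar F (x * q u)\<close> by an annihilating form.\<close>

lemma hilbert_function_eq_dual_system:
  fixes F :: "(nat, 'k::field_char_0) mpoly"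
  assumes F: "F \<in> graded_part {..<n} d" "F \<noteq> 0" and k: "k \<le> d"
    and sys: "dual_system n F k (d - k) p q r"
    and maximal: "\<nexists>p q. dual_system n F k (d - k) p q (Suc r)"
  shows "hilbert_function n F k = r"
proof -
  interpret R: cring "poly_ring n :: (nat, 'k) mpoly ring" by (rule poly_ring_cring)
  interpret I: ideal "Ann n F" "poly_ring n" by (rule Ann_ideal)
  define cls where "cls = (+>\<^bsub>poly_ring n\<^esub>) (Ann n F)"
  let ?A = "dual_algebra n F"
  interpret h: ring_hom_ring "poly_ring n" ?A cls
    unfolding cls_def dual_algebra_def by (rule I.rcos_ring_hom_ring)
  have hom: "cls (const c * x + y) = cls (const c) \<otimes>\<^bsub>?A\<^esub> cls x \<oplus>\<^bsub>?A\<^esub> cls y"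
    if "x \<in> polys_in {..<n}" "y \<in> polys_in {..<n}" for c x y
    using that h.hom_add[of "const c * x" y] h.hom_mult[of "const c" x]
    by (simp add: polys_in_const polys_in_mult)
  have eq_iff: "cls x = cls y \<longleftrightarrow> x - y \<in> Ann n F"
    if "x \<in> polys_in {..<n}" "y \<in> polys_in {..<n}" for x y
    unfolding cls_def using that by (rule Ann_coset_eq_iff)
  have graded: "p u \<in> graded_part {..<n} k" if "u < r" for u
    using sys that by (simp add: dual_system_def)
  then have poly: "p u \<in> polys_in {..<n}" if "u < r" for u
    using that by (simp add: graded_part_def)
  define comb where "comb c t = (\<Sum>u<t. const (c u) * p u)" for c t
  have comb_poly: "comb c t \<in> polys_in {..<n}" if "t \<le> r" for c t
    unfolding comb_def using that
    by (intro polys_in_sum polys_in_mult polys_in_const poly) auto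
  \<comment> \<open>The space spanned by the first \<open>t\<close> classes grows by one dimension with every step.\<close>
  have dim: "h.S.dimension t (scalars n F) (range (\<lambda>c. cls (comb c t)))" if "t \<le> r" for t
    using that
  proof (induction t)
    case 0
    have "range (\<lambda>c. cls (comb c 0)) = {\<zero>\<^bsub>?A\<^esub>}"
      using h.hom_zero by (simp add: comb_def)
    then show ?case by simp
  next
    case (Suc t)
    let ?E = "range (\<lambda>c. cls (comb c t))"
    have t: "t < r" using Suc.prems by simp
    have "cls (p t) \<notin> ?E"
    proof
      assume "cls (p t) \<in> ?E"
      then obtain c where "p t - comb c t \<in> Ann n F"
        using eq_iff poly comb_poly t by force
      then have "apolar F ((p t - comb c t) * q t) = 0" by (simp add: mem_Ann_iff)
      moreover have "apolar F (comb c t * q t) = 0"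
        using apolar_combination[OF sys t, of t c] t by (simp add: comb_def)
      moreover have "apolar F (p t * q t) = 1" using sys t by (simp add: dual_system_def)
      ultimately show False by (simp add: left_diff_distrib apolar_diff)
    qed
    moreover have "h.S.line_extension (scalars n F) (cls (p t)) ?E =
        range (\<lambda>c. cls (comb c (Suc t)))"
    proof -
      have step: "cls (comb c (Suc t)) = cls (const (c t)) \<otimes>\<^bsub>?A\<^esub> cls (p t) \<oplus>\<^bsub>?A\<^esub> cls (comb c t)" for c
        using hom[of "p t" "comb c t" "c t"] poly comb_poly t by (simp add: comb_def add.commute)
      have merge: "cls (const b) \<otimes>\<^bsub>?A\<^esub> cls (p t) \<oplus>\<^bsub>?A\<^esub> cls (comb c t) = cls (comb (c(t := b)) (Suc t))" for b c
      proof -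
        have "comb (c(t := b)) t = comb c t" by (simp add: comb_def)
        then show ?thesis by (simp add: step)
      qed
      show ?thesis
      proof (intro equalityI subsetI)
        fix z assume "z \<in> h.S.line_extension (scalars n F) (cls (p t)) ?E"
        then obtain b c where "z = cls (const b) \<otimes>\<^bsub>?A\<^esub> cls (p t) \<oplus>\<^bsub>?A\<^esub> cls (comb c t)"
          unfolding h.S.line_extension_mem_iff by (auto simp: scalars_def cls_def)
        then show "z \<in> range (\<lambda>c. cls (comb c (Suc t)))" by (simp add: merge)
      next
        fix z assume "z \<in> range (\<lambda>c. cls (comb c (Suc t)))"
        then obtain c where "z = cls (const (c t)) \<otimes>\<^bsub>?A\<^esub> cls (p t) \<oplus>\<^bsub>?A\<^esub> cls (comb c t)"
          by (auto simp: step)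
        then show "z \<in> h.S.line_extension (scalars n F) (cls (p t)) ?E"
          unfolding h.S.line_extension_mem_iff by (auto simp: scalars_def cls_def)
      qed
    qed
    moreover have "cls (p t) \<in> carrier ?A" using h.hom_closed poly t by simp
    ultimately show ?case
      using h.S.dimension.Suc_dim[of "cls (p t)" ?E t "scalars n F"] Suc.IH t by simp
  qed
  have "range (\<lambda>c. cls (comb c r)) = algebra_part n F k"
  proof (intro equalityI subsetI)
    fix z assume "z \<in> range (\<lambda>c. cls (comb c r))"
    then show "z \<in> algebra_part n F k"
      unfolding algebra_part_def comb_def cls_def
      by (auto intro!: imageI graded_part_sum graded_part_const_mult graded)
  next
    fix z assume "z \<in> algebra_part n F k"
    then obtain x where x: "x \<in> graded_part {..<n} k" and z: "z = cls x"
      by (auto simp: algebra_part_def cls_def)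
    define c where "c u = apolar F (x * q u)" for u
    let ?x' = "x - comb c r"
    have x': "?x' \<in> graded_part {..<n} k"
      unfolding comb_def by (intro graded_part_diff x graded_part_sum graded_part_const_mult graded) auto
    have "apolar F (?x' * q v) = 0" if "v < r" for v
      using apolar_combination[OF sys that order.refl, of c] that
      by (simp add: left_diff_distrib apolar_diff comb_def c_def)
    with maximal dual_system_extend[OF sys x'] have "\<forall>y \<in> graded_part {..<n} (d - k). apolar F (?x' * y) = 0"
      by blast
    then have "?x' \<in> Ann n F" using graded_mem_Ann_iff[OF F(1) x' k] by simp
    then have "z = cls (comb c r)"
      using x comb_poly by (simp add: z eq_iff graded_part_def)
    then show "z \<in> range (\<lambda>c. cls (comb c r))" by blast
  qed
  with dim[OF order.refl] have "h.S.dimension r (scalars n F) (algebra_part n F k)" by simp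
  with h.S.dimI[OF scalars_subfield[OF F(2), of n]] show ?thesis
    unfolding hilbert_function_def over_def by blast
qed

text \<open>The identity matrix of size \<open>r\<close> has rank \<open>r\<close>, so it does not factor through a space of
  smaller dimension. If \<open>I\<close> were too small, padding the factors with zeros would give square
  matrices \<open>A\<close>, \<open>B\<close> with \<open>A * B = 1\<close> although \<open>B * A\<close> has a zero row.\<close>

lemma le_card_if_factors_identity:
  fixes f :: "nat \<Rightarrow> 'i \<Rightarrow> 'k::field" and g :: "'i \<Rightarrow> nat \<Rightarrow> 'k"
  assumes "finite I"
    and id: "\<And>u v. u < r \<Longrightarrow> v < r \<Longrightarrow> (\<Sum>i\<in>I. f u i * g i v) = (if u = v then 1 else 0)"
  shows "r \<le> card I"
proof (rule ccontr)
  assume "\<not> r \<le> card I"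
  then have less: "card I < r" by simp
  obtain h where h: "bij_betw h {0..<card I} I"
    using ex_bij_betw_nat_finite[OF \<open>finite I\<close>] by blast
  define A where "A = mat r r (\<lambda>(u, i). if i < card I then f u (h i) else 0)"
  define B where "B = mat r r (\<lambda>(i, v). if i < card I then g (h i) v else 0)"
  have AB: "A * B = 1\<^sub>m r"
  proof (rule eq_matI)
    fix u v assume "u < dim_row (1\<^sub>m r :: 'k mat)" "v < dim_col (1\<^sub>m r :: 'k mat)"
    then have uv: "u < r" "v < r" by simp_all
    then have "(A * B) $$ (u, v) = (\<Sum>i\<in>{0..<r}. if i < card I then f u (h i) * g (h i) v else 0)"
      by (auto simp: A_def B_def scalar_prod_def intro!: sum.cong)
    also have "\<dots> = (\<Sum>i\<in>{0..<card I}. f u (h i) * g (h i) v)"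
      using less by (intro sum.mono_neutral_cong_right) auto
    also have "\<dots> = (\<Sum>i\<in>I. f u i * g i v)"
      by (rule sum.reindex_bij_betw[OF h])
    finally show "(A * B) $$ (u, v) = (1\<^sub>m r :: 'k mat) $$ (u, v)" using id uv by simp
  qed (simp_all add: A_def B_def)
  have "B * A = 1\<^sub>m r"
    by (rule mat_mult_left_right_inverse[OF _ _ AB]) (simp_all add: A_def B_def)
  moreover have "(B * A) $$ (card I, card I) = 0"
    using less by (simp add: A_def B_def scalar_prod_def)
  ultimately show False using less by simp
qed

definition monomials :: "nat \<Rightarrow> nat \<Rightarrow> (nat \<Rightarrow>\<^sub>0 nat) set" where
  "monomials n k = {m. Poly_Mapping.keys m \<subseteq> {..<n} \<and> mon_deg m = k}"

text \<open>Reading exponent vectors as lists reduces the count of monomials to the count of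
  compositions with zeros.\<close>

lemma bij_betw_monomials:
  "bij_betw (\<lambda>m. map (Poly_Mapping.lookup m) [0..<n]) (monomials n k)
    {l::nat list. length l = n \<and> sum_list l = k}"
proof (rule bij_betwI[where g = "\<lambda>l. \<Sum>i<n. Poly_Mapping.single i (l ! i)"])
  have deg: "mon_deg m = (\<Sum>i<n. Poly_Mapping.lookup m i)" if "Poly_Mapping.keys m \<subseteq> {..<n}" for m :: "nat \<Rightarrow>\<^sub>0 nat"
    using that by (intro mon_deg_superset) auto
  show "(\<lambda>m. map (Poly_Mapping.lookup m) [0..<n])
      \<in> monomials n k \<rightarrow> {l. length l = n \<and> sum_list l = k}"
    by (auto simp: monomials_def deg interv_sum_list_conv_sum_set_nat atLeast0LessThan)
  have lookup: "Poly_Mapping.lookup (\<Sum>i<n. Poly_Mapping.single i (f i)) j = (if j < n then f j else 0)"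
    for f :: "nat \<Rightarrow> nat" and j
    by (simp add: lookup_sum lookup_single when_def)
  show "(\<lambda>l. \<Sum>i<n. Poly_Mapping.single i (l ! i)) \<in> {l. length l = n \<and> sum_list l = k} \<rightarrow> monomials n k"
  proof
    fix l :: "nat list" assume l: "l \<in> {l. length l = n \<and> sum_list l = k}"
    have keys: "Poly_Mapping.keys (\<Sum>i<n. Poly_Mapping.single i (l ! i)) \<subseteq> {..<n}"
      by (auto simp: in_keys_iff lookup split: if_splits)
    have "(\<Sum>i<n. l ! i) = k" using l by (auto simp: sum_list_sum_nth atLeast0LessThan)
    with keys show "(\<Sum>i<n. Poly_Mapping.single i (l ! i)) \<in> monomials n k"
      by (simp add: monomials_def deg lookup)
  qed
  show "(\<Sum>i<n. Poly_Mapping.single i (map (Poly_Mapping.lookup m) [0..<n] ! i)) = m"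
    if "m \<in> monomials n k" for m
  proof (rule poly_mapping_eqI)
    fix j
    have "j < n \<or> Poly_Mapping.lookup m j = 0"
      using that unfolding monomials_def mem_Collect_eq
      by (meson lessThan_iff not_in_keys_iff_lookup_eq_zero subsetD)
    then show "Poly_Mapping.lookup (\<Sum>i<n. Poly_Mapping.single i (map (Poly_Mapping.lookup m) [0..<n] ! i)) j
        = Poly_Mapping.lookup m j"
      by (auto simp: lookup)
  qed
  show "map (Poly_Mapping.lookup (\<Sum>i<n. Poly_Mapping.single i (l ! i))) [0..<n] = l"
    if "l \<in> {l. length l = n \<and> sum_list l = k}" for l
    using that by (intro nth_equalityI) (simp_all add: lookup)
qed

lemma card_monomials: "card (monomials n k) = (n + k - 1) choose k"
  using bij_betw_same_card[OF bij_betw_monomials[of n k]] card_length_sum_list[of n k]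
  by (simp add: add.commute)

lemma finite_monomials: "finite (monomials n k)"
proof -
  have "{l::nat list. length l = n \<and> sum_list l = k} \<subseteq> {l. set l \<subseteq> {..k} \<and> length l = n}"
    using member_le_sum_list by fastforce
  then have "finite {l::nat list. length l = n \<and> sum_list l = k}"
    by (rule finite_subset) (simp add: finite_lists_length_eq)
  then show ?thesis using bij_betw_finite[OF bij_betw_monomials] by blast
qed

text \<open>The pairing factors through the coefficient vector of \<open>p u\<close>.\<close>

lemma dual_system_le_monomials:
  assumes "dual_system n F k l p q r"
  shows "r \<le> card (monomials n k)"
proof (rule le_card_if_factors_identity[OF finite_monomials])
  fix u v assume uv: "u < r" "v < r"
  have "p u \<in> graded_part {..<n} k" using assms uv by (simp add: dual_system_def)
  then have keys: "Poly_Mapping.keys (p u) \<subseteq> monomials n k"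
    by (auto simp: graded_part_def polys_in_def monomials_def)
  have "apolar F (p u * q v) =
      (\<Sum>m\<in>monomials n k. Poly_Mapping.lookup (p u) m * lin_ext (\<lambda>m'. dp_coeff F (m + m')) (q v))"
    unfolding apolar_def lin_ext_mult by (rule lin_ext_superset[OF finite_monomials keys])
  then show "(\<Sum>m\<in>monomials n k. Poly_Mapping.lookup (p u) m * lin_ext (\<lambda>m'. dp_coeff F (m + m')) (q v))
      = (if u = v then 1 else 0)"
    using assms uv by (simp add: dual_system_def)
qed

text \<open>For a sum of \<open>s\<close> powers the pairing factors through the values at the \<open>s\<close> points.\<close>

lemma dual_system_power_sum_le:
  assumes sys: "dual_system n (power_sum n d s a) k (d - k) p q r" and "k \<le> d"
  shows "r \<le> s"
proof -
  have "r \<le> card {..<s}"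
  proof (rule le_card_if_factors_identity)
    fix u v assume uv: "u < r" "v < r"
    have "p u * q v \<in> graded_part {..<n} (k + (d - k))"
      using sys uv by (intro graded_part_mult) (auto simp: dual_system_def)
    then have "apolar (power_sum n d s a) (p u * q v) =
        fact d * (\<Sum>i<s. eval_at (\<lambda>j. a (i, j)) (p u * q v))"
      using \<open>k \<le> d\<close> by (intro apolar_power_sum) simp
    then show "(\<Sum>i<s. (fact d * eval_at (\<lambda>j. a (i, j)) (p u)) * eval_at (\<lambda>j. a (i, j)) (q v)) =
        (if u = v then 1 else 0)"
      using sys uv by (simp add: dual_system_def eval_at_mult sum_distrib_left mult.assoc)
  qed simp
  then show ?thesis by simp
qed

lemma dual_system_empty: "dual_system n F k l p q 0"
  by (simp add: dual_system_def)

lemma maximal_dual_system_exists: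
  "\<exists>r p q. dual_system n F k l p q r \<and> (\<nexists>p q. dual_system n F k l p q (Suc r))"
proof -
  let ?P = "\<lambda>r. \<exists>p q. dual_system n F k l p q r"
  have bound: "r \<le> card (monomials n k)" if "?P r" for r
    using that dual_system_le_monomials by blast
  have "?P (GREATEST r. ?P r)"
    by (rule GreatestI_ex_nat[of ?P, OF _ bound]) (use dual_system_empty in blast)
  moreover have "\<not> ?P (Suc (GREATEST r. ?P r))"
    using Greatest_le_nat[of ?P, OF _ bound] not_less_eq_eq by blast
  ultimately show ?thesis by blast
qed

text \<open>A maximal dual system between degrees \<open>k\<close> and \<open>d - k\<close>, read backwards, is a maximal dual
  system between degrees \<open>d - k\<close> and \<open>k\<close>.\<close>

lemma hilbert_function_symmetric:
  fixes F :: "(nat, 'k::field_char_0) mpoly"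
  assumes F: "F \<in> graded_part {..<n} d" "F \<noteq> 0" and k: "k \<le> d"
  shows "hilbert_function n F k = hilbert_function n F (d - k)"
proof -
  obtain p q r where sys: "dual_system n F k (d - k) p q r"
    and max: "\<nexists>p q. dual_system n F k (d - k) p q (Suc r)"
    using maximal_dual_system_exists by blast
  have "hilbert_function n F k = r"
    by (rule hilbert_function_eq_dual_system[OF F k sys max])
  moreover have "hilbert_function n F (d - k) = r"
  proof (rule hilbert_function_eq_dual_system[OF F])
    show "dual_system n F (d - k) (d - (d - k)) q p r"
      using dual_system_sym[OF sys] k by simp
    show "\<nexists>p q. dual_system n F (d - k) (d - (d - k)) p q (Suc r)"
      using max dual_system_sym k by (metis diff_diff_cancel)
  qed simp
  ultimately show ?thesis by simp
qed

section \<open>Points in general position\<close>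

text \<open>The matrix of the form \<open>(f, g) \<mapsto> \<Sum>\<^sub>i a\<^sub>i\<^sub>0\<^sup>e f(a\<^sub>i) g(a\<^sub>i)\<close> on the span of the monomials
  \<open>\<mu> u\<close>. With \<open>e = d - 2 k\<close> and \<open>\<mu> u\<close> of degree \<open>k\<close> it is, up to \<open>d!\<close>, the matrix of the apolar
  pairing of \<open>\<mu> u\<close> with \<open>x\<^sub>0\<^sup>d\<^sup>-\<^sup>2\<^sup>k \<mu> v\<close>. The power of \<open>x\<^sub>0\<close> makes up for the difference of
  the degrees \<open>k\<close> and \<open>d - k\<close>, so that the same monomials serve on both sides and positivity applies.
  The ring is arbitrary because the matrix is specialised from polynomials and from the integers.\<close>

definition gram :: "nat \<Rightarrow> nat \<Rightarrow> (nat \<Rightarrow> nat \<Rightarrow>\<^sub>0 nat) \<Rightarrow> nat \<Rightarrow> (nat \<times> nat \<Rightarrow> 'k::comm_ring_1) \<Rightarrow> 'k mat" where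
  "gram s e \<mu> r a = mat r r (\<lambda>(u, v). \<Sum>i<s.
     a (i, 0) ^ e * monom_val (\<lambda>j. a (i, j)) (\<mu> u) * monom_val (\<lambda>j. a (i, j)) (\<mu> v))"

lemma gram_carrier [simp]: "gram s e \<mu> r a \<in> carrier_mat r r"
  by (simp add: gram_def)

lemma gram_hom:
  assumes "comm_ring_hom h"
  shows "map_mat h (gram s e \<mu> r a) = gram s e \<mu> r (h \<circ> a)"
proof -
  interpret comm_ring_hom h by fact
  have "h (monom_val b m) = monom_val (\<lambda>j. h (b j)) m" for b :: "nat \<Rightarrow> 'a" and m
    by (simp add: monom_val_def hom_distribs)
  then show ?thesis
    by (intro eq_matI) (simp_all add: gram_def hom_distribs)
qed

lemma gram_cong:
  assumes "\<And>u. u < r \<Longrightarrow> Poly_Mapping.keys (\<mu> u) \<subseteq> {..<n}" "0 < n"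
    and "\<And>i j. i < s \<Longrightarrow> j < n \<Longrightarrow> a (i, j) = b (i, j)"
  shows "gram s e \<mu> r a = gram s e \<mu> r b"
proof (rule eq_matI)
  fix u v assume "u < dim_row (gram s e \<mu> r b)" "v < dim_col (gram s e \<mu> r b)"
  then have uv: "u < r" "v < r" by (simp_all add: gram_def)
  have "monom_val (\<lambda>j. a (i, j)) (\<mu> w) = monom_val (\<lambda>j. b (i, j)) (\<mu> w)" if "i < s" "w < r" for i w
    using assms(1)[OF that(2)] assms(3) that by (intro monom_val_cong) auto
  with uv assms(2,3) show "gram s e \<mu> r a $$ (u, v) = gram s e \<mu> r b $$ (u, v)"
    by (simp add: gram_def)
qed (simp_all add: gram_def)

text \<open>Vandermonde: a relation between the sequences of powers of the \<open>y u\<close> is a relation between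
  the evaluations at the \<open>y u\<close> on polynomials of degree less than \<open>r\<close>; apply it to the one that
  vanishes at all \<open>y u\<close> except \<open>y w\<close>.\<close>

lemma power_functions_independent:
  fixes y :: "nat \<Rightarrow> 'k::idom"
  assumes inj: "inj_on y {..<r}"
    and zero: "\<And>i. i < r \<Longrightarrow> (\<Sum>u<r. c u * y u ^ i) = 0" and w: "w < r"
  shows "c w = 0"
proof -
  define L where "L = (\<Prod>u\<in>{..<r} - {w}. [:- y u, 1:])"
  have "degree L = card ({..<r} - {w})"
    unfolding L_def by (subst degree_prod_eq_sum_degree) auto
  then have deg: "degree L < r" using w by simp
  have L: "poly L (y u) = 0" if "u < r" "u \<noteq> w" for u
    unfolding L_def poly_prod using that by (intro prod_zero) auto
  have "poly L (y w) \<noteq> 0"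
    unfolding L_def poly_prod using inj w by (auto simp: inj_on_def)
  moreover have "c w * poly L (y w) = 0"
  proof -
    have "c w * poly L (y w) = (\<Sum>u<r. c u * poly L (y u))"
      using w L by (subst sum.remove[of _ w]) auto
    also have "\<dots> = (\<Sum>u<r. \<Sum>i\<le>degree L. poly.coeff L i * (c u * y u ^ i))"
      by (simp add: poly_altdef sum_distrib_left ac_simps)
    also have "\<dots> = (\<Sum>i\<le>degree L. poly.coeff L i * (\<Sum>u<r. c u * y u ^ i))"
      by (subst sum.swap) (simp add: sum_distrib_left)
    also have "\<dots> = 0" using zero deg by simp
    finally show ?thesis .
  qed
  ultimately show ?thesis by simp
qed

text \<open>Unique factorisation: the exponents can be read off from the value.\<close>

lemma inj_on_monom_val_primes:
  fixes \<pi> :: "nat \<Rightarrow> nat"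
  assumes inj: "inj_on \<pi> {..<n}" and prime: "\<And>j. j < n \<Longrightarrow> prime (\<pi> j)"
  shows "inj_on (monom_val \<pi>) {m. Poly_Mapping.keys m \<subseteq> {..<n}}"
proof (rule inj_onI, rule poly_mapping_eqI)
  fix m m' j
  assume keys: "m \<in> {m. Poly_Mapping.keys m \<subseteq> {..<n}}" "m' \<in> {m. Poly_Mapping.keys m \<subseteq> {..<n}}"
    and eq: "monom_val \<pi> m = monom_val \<pi> m'"
  have mult: "multiplicity (\<pi> j) (monom_val \<pi> m) = Poly_Mapping.lookup m j"
    if "Poly_Mapping.keys m \<subseteq> {..<n}" "j < n" for m
  proof -
    have "monom_val \<pi> m = (\<Prod>j<n. \<pi> j ^ Poly_Mapping.lookup m j)"
      using that by (intro monom_val_superset) auto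
    also have "\<dots> = (\<Prod>p\<in>\<pi> ` {..<n}. p ^ Poly_Mapping.lookup m (the_inv_into {..<n} \<pi> p))"
      using inj by (simp add: prod.reindex the_inv_into_f_f)
    also have "multiplicity (\<pi> j) \<dots> = Poly_Mapping.lookup m j"
      using prime that inj by (subst multiplicity_prod_prime_powers) (auto simp: the_inv_into_f_f)
    finally show ?thesis .
  qed
  show "Poly_Mapping.lookup m j = Poly_Mapping.lookup m' j"
  proof (cases "j < n")
    case True
    then show ?thesis using mult[of m] mult[of m'] keys eq by simp
  next
    case False
    then have "j \<notin> Poly_Mapping.keys m" "j \<notin> Poly_Mapping.keys m'" using keys by auto
    then show ?thesis by (simp add: in_keys_iff)
  qed
qed

text \<open>At the \<open>i\<close>-th point \<open>(\<pi>\<^sub>0\<^sup>i, \<pi>\<^sub>1\<^sup>i, \<dots>)\<close> a monomial takes the \<open>i\<close>-th power of its value \<open>y\<close> at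
  \<open>(\<pi>\<^sub>0, \<pi>\<^sub>1, \<dots>)\<close>, and these values are distinct. Over the integers the form is a sum of squares with
  positive weights, so a kernel vector \<open>c\<close> gives a combination of monomials that vanishes at all
  points, i.e. a relation between the first \<open>s\<close> powers of the \<open>r \<le> s\<close> numbers \<open>y u\<close>.\<close>

lemma det_gram_prime_powers:
  fixes \<pi> :: "nat \<Rightarrow> nat"
  assumes inj\<pi>: "inj_on \<pi> {..<n}" and prime: "\<And>j. j < n \<Longrightarrow> prime (\<pi> j)" and n: "0 < n"
    and inj\<mu>: "inj_on \<mu> {..<r}" and keys: "\<And>u. u < r \<Longrightarrow> Poly_Mapping.keys (\<mu> u) \<subseteq> {..<n}"
    and "r \<le> s"
  shows "det (gram s e \<mu> r (\<lambda>(i, j). int (\<pi> j) ^ i)) \<noteq> 0"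
proof
  let ?a = "\<lambda>(i, j). int (\<pi> j) ^ i"
  define y where "y u = int (monom_val \<pi> (\<mu> u))" for u
  have val: "monom_val (\<lambda>j. ?a (i, j)) (\<mu> u) = y u ^ i" for i u
    by (simp add: monom_val_def y_def prod_power_distrib power_mult[symmetric] mult.commute)
  have "inj_on y {..<r}"
    using inj_onD[OF inj_on_monom_val_primes[OF inj\<pi> prime]] keys inj_onD[OF inj\<mu>]
    by (intro inj_onI) (simp add: y_def)
  assume "det (gram s e \<mu> r ?a) = 0"
  then obtain c where c: "c \<in> carrier_vec r" "c \<noteq> 0\<^sub>v r" "gram s e \<mu> r ?a *\<^sub>v c = 0\<^sub>v r"
    using det_0_iff_vec_prod_zero[OF gram_carrier] by blast
  define Y where "Y i = (\<Sum>u<r. c $ u * y u ^ i)" for i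
  \<comment> \<open>\<open>Y i\<close> is the value at the \<open>i\<close>-th point, and this sum is the form evaluated at \<open>c\<close>.\<close>
  have "(\<Sum>i<s. ?a (i, 0) ^ e * (Y i)\<^sup>2) = 0"
  proof -
    have row: "(\<Sum>i<s. ?a (i, 0) ^ e * y u ^ i * Y i) = 0" if "u < r" for u
    proof -
      have "0 = (gram s e \<mu> r ?a *\<^sub>v c) $ u" using c(3) that by simp
      also have "\<dots> = (\<Sum>v<r. (\<Sum>i<s. ?a (i, 0) ^ e * y u ^ i * y v ^ i) * c $ v)"
        using that c(1) by (simp add: gram_def scalar_prod_def val[simplified] atLeast0LessThan)
      also have "\<dots> = (\<Sum>i<s. ?a (i, 0) ^ e * y u ^ i * Y i)"
        unfolding Y_def sum_distrib_right sum_distrib_left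
        by (subst sum.swap) (simp add: ac_simps)
      finally show ?thesis by simp
    qed
    have "(\<Sum>i<s. ?a (i, 0) ^ e * (Y i)\<^sup>2) = (\<Sum>u<r. c $ u * (\<Sum>i<s. ?a (i, 0) ^ e * y u ^ i * Y i))"
      unfolding sum_distrib_left
      by (subst sum.swap) (simp add: power2_eq_square Y_def sum_distrib_left sum_distrib_right ac_simps)
    also have "\<dots> = 0" using row by simp
    finally show ?thesis .
  qed
  then have "?a (i, 0) ^ e * (Y i)\<^sup>2 = 0" if "i < s" for i
    using that by (subst (asm) sum_nonneg_eq_0_iff) auto
  then have "Y i = 0" if "i < s" for i
    using that prime_gt_0_nat[OF prime[OF n]] by auto
  then have "c $ u = 0" if "u < r" for u
    using power_functions_independent[OF \<open>inj_on y {..<r}\<close>, of "\<lambda>u. c $ u" u] that \<open>r \<le> s\<close>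
    by (simp add: Y_def)
  then have "c = 0\<^sub>v r" using c(1) by (intro eq_vecI) auto
  with c(2) show False by simp
qed

text \<open>The inverse matrix turns the forms \<open>x\<^sub>0\<^sup>d\<^sup>-\<^sup>2\<^sup>k \<mu> v\<close> into partners of the monomials \<open>\<mu> u\<close>.\<close>

lemma dual_system_if_gram_nonsingular:
  fixes a :: "nat \<times> nat \<Rightarrow> 'k::field_char_0"
  assumes det: "det (gram s (d - 2 * k) \<mu> r a) \<noteq> 0" and "2 * k \<le> d" and n: "0 < n"
    and \<mu>: "\<And>u. u < r \<Longrightarrow> \<mu> u \<in> monomials n k"
  shows "\<exists>p q. dual_system n (power_sum n d s a) k (d - k) p q r"
proof -
  let ?F = "power_sum n d s a" and ?G = "gram s (d - 2 * k) \<mu> r a"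
  obtain C where C: "C \<in> carrier_mat r r" "?G * C = 1\<^sub>m r"
    using det_non_zero_imp_unit[OF gram_carrier det]
    by (auto simp: Units_def ring_mat_def)
  define x where "x u = Poly_Mapping.single (\<mu> u) (1::'k)" for u
  define z where "z = Poly_Mapping.single (Poly_Mapping.single (0::nat) (d - 2 * k)) (1::'k)"
  define q where "q v = const (inverse (fact d)) * (\<Sum>w<r. const (C $$ (w, v)) * (z * x w))" for v
  have x: "x u \<in> graded_part {..<n} k" if "u < r" for u
    unfolding x_def using \<mu>[OF that] by (intro graded_part_single) (auto simp: monomials_def)
  have z: "z \<in> graded_part {..<n} (d - 2 * k)"
    unfolding z_def using n by (intro graded_part_single) auto
  have zx: "z * x w \<in> graded_part {..<n} (d - k)" if "w < r" for w
    using graded_part_mult[OF z x[OF that]] \<open>2 * k \<le> d\<close> by (simp add: algebra_simps)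
  have q: "q v \<in> graded_part {..<n} (d - k)" for v
    unfolding q_def by (intro graded_part_const_mult graded_part_sum zx) simp
  have G: "apolar ?F (x u * (z * x w)) = fact d * ?G $$ (u, w)" if "u < r" "w < r" for u w
  proof -
    have "x u * (z * x w) \<in> graded_part {..<n} d"
      using graded_part_mult[OF x[OF that(1)] zx[OF that(2)]] \<open>2 * k \<le> d\<close> by simp
    then show ?thesis using that
      by (simp add: apolar_power_sum eval_at_mult x_def z_def eval_at_single gram_def ac_simps)
  qed
  have cancel: "inverse (fact d) * (c * (fact d * g)) = g * c" for c g :: 'k
    by (simp add: field_simps)
  have "apolar ?F (x u * q v) = (if u = v then 1 else 0)" if "u < r" "v < r" for u v
  proof -
    have "apolar ?F (x u * q v) = inverse (fact d) * (\<Sum>w<r. C $$ (w, v) * apolar ?F (x u * (z * x w)))"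
      by (simp add: q_def apolar_const_mult apolar_sum sum_distrib_left mult.left_commute[of "x u" "const _"])
    also have "\<dots> = (\<Sum>w<r. ?G $$ (u, w) * C $$ (w, v))"
      unfolding sum_distrib_left using that by (intro sum.cong refl) (simp add: G cancel)
    also have "\<dots> = (?G * C) $$ (u, v)"
      using that C(1) carrier_matD[OF gram_carrier[of s "d - 2 * k" \<mu> r a]]
      by (simp add: scalar_prod_def atLeast0LessThan)
    finally show ?thesis using C(2) that by simp
  qed
  then have "dual_system n ?F k (d - k) x q r"
    using x q by (simp add: dual_system_def)
  then show ?thesis by blast
qed

theorem proposition3p1:
  fixes n d s :: nat
  assumes "n \<ge> 2" and "d \<ge> 1" and "s \<ge> 1" and "s \<le> (n + d - 1) choose (n - 1)"
  shows "\<exists>U :: (nat \<times> nat \<Rightarrow> 'k::{alg_closed_field, field_char_0}) set.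
    zariski_open ({..<s} \<times> {..<n}) U \<and> U \<noteq> {} \<and>
    (\<forall>a\<in>U. let h = hilbert_function n (power_sum n d s a) in
       (\<forall>k \<le> d div 2. h k = min ((n + k - 1) choose k) s) \<and>
       (\<forall>k. d div 2 < k \<and> k \<le> d \<longrightarrow> h k = h (d - k)))"
proof -
  let ?I = "{..<s} \<times> {..<n}"
  have n: "0 < n" using assms(1) by simp
  define r where "r k = min ((n + k - 1) choose k) s" for k
  have "\<exists>\<mu>. bij_betw \<mu> {0..<card (monomials n k)} (monomials n k)" for k
    by (rule ex_bij_betw_nat_finite[OF finite_monomials])
  then obtain \<mu> where \<mu>: "\<And>k. bij_betw (\<mu> k) {0..<card (monomials n k)} (monomials n k)" by metis
  have \<mu>_mem: "\<mu> k u \<in> monomials n k" if "u < r k" for k u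
    using bij_betwE[OF \<mu>[of k]] that by (simp add: r_def card_monomials)
  then have \<mu>_keys: "Poly_Mapping.keys (\<mu> k u) \<subseteq> {..<n}" if "u < r k" for k u
    using that by (auto simp: monomials_def)
  have \<mu>_inj: "inj_on (\<mu> k) {..<r k}" for k
    by (rule inj_on_subset[OF bij_betw_imp_inj_on[OF \<mu>[of k]]]) (auto simp: r_def card_monomials)
  \<comment> \<open>The product collects the conditions for all \<open>k\<close> in one polynomial; it is nonzero because
    the determinants have a common point of nonvanishing.\<close>
  define D :: "(nat \<times> nat, 'k) mpoly" where
    "D = (\<Prod>k\<le>d div 2. det (gram s (d - 2 * k) (\<mu> k) (r k) var))"
  have eval: "eval_at a D = (\<Prod>k\<le>d div 2. det (gram s (d - 2 * k) (\<mu> k) (r k) a))" for a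
  proof -
    interpret comm_ring_hom "eval_at a" by (rule eval_at_hom)
    have "eval_at a \<circ> var = a" by (simp add: fun_eq_iff eval_at_var)
    then show ?thesis by (simp add: D_def hom_distribs gram_hom[OF eval_at_hom] flip: hom_det)
  qed
  define U where "U = affine_space ?I - zero_locus ?I {D}"
  have "D \<in> polys_in ?I"
    unfolding D_def
  proof (intro polys_in_prod polys_in_det[OF gram_carrier])
    fix k u v assume uv: "u < r k" "v < r k"
    have "(monom_val (\<lambda>j. var (i, j)) (\<mu> k w) :: (nat \<times> nat, 'k) mpoly) \<in> polys_in ?I"
      if "i < s" "w < r k" for i w
      unfolding monom_val_def using \<mu>_keys[OF that(2)] that
      by (intro polys_in_prod polys_in_power polys_in_var) auto
    then show "(gram s (d - 2 * k) (\<mu> k) (r k) var :: (nat \<times> nat, 'k) mpoly mat) $$ (u, v) \<in> polys_in ?I"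
      using uv n by (auto simp: gram_def intro!: polys_in_sum polys_in_mult polys_in_power polys_in_var)
  qed
  then have "zariski_open ?I U"
    unfolding zariski_open_def U_def by (intro exI[of _ "{D}"]) simp
  moreover have "U \<noteq> {}"
  proof -
    \<comment> \<open>The integer matrix at powers of primes is carried to the field, where characteristic zero
      keeps its determinant nonzero.\<close>
    obtain \<pi> :: "nat \<Rightarrow> nat" where \<pi>: "inj \<pi>" "range \<pi> \<subseteq> {p. prime p}"
      using infinite_countable_subset[OF primes_infinite] by blast
    let ?b = "\<lambda>(i, j). int (\<pi> j) ^ i"
    define a :: "nat \<times> nat \<Rightarrow> 'k" where "a = restrict (of_int \<circ> ?b) ?I"
    have "det (gram s (d - 2 * k) (\<mu> k) (r k) a) \<noteq> 0" for k
    proof -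
      have "det (gram s (d - 2 * k) (\<mu> k) (r k) ?b) \<noteq> 0"
      proof (rule det_gram_prime_powers[OF _ _ n \<mu>_inj \<mu>_keys])
        show "inj_on \<pi> {..<n}" by (rule inj_on_subset[OF \<pi>(1)]) simp
        show "prime (\<pi> j)" for j using \<pi>(2) by blast
        show "r k \<le> s" by (simp add: r_def)
      qed
      moreover have "gram s (d - 2 * k) (\<mu> k) (r k) a = gram s (d - 2 * k) (\<mu> k) (r k) (of_int \<circ> ?b)"
        using \<mu>_keys n by (intro gram_cong) (auto simp: a_def)
      moreover have "\<dots> = map_mat of_int (gram s (d - 2 * k) (\<mu> k) (r k) ?b)"
        by (rule gram_hom[symmetric]) (rule of_int_hom.comm_ring_hom_axioms)
      ultimately show ?thesis by simp
    qed
    then have "eval_at a D \<noteq> 0" by (simp add: eval)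
    moreover have "a \<in> affine_space ?I" by (auto simp: affine_space_def a_def)
    ultimately show ?thesis by (auto simp: U_def zero_locus_def)
  qed
  moreover have "let h = hilbert_function n (power_sum n d s a) in
       (\<forall>k \<le> d div 2. h k = min ((n + k - 1) choose k) s) \<and>
       (\<forall>k. d div 2 < k \<and> k \<le> d \<longrightarrow> h k = h (d - k))" if a: "a \<in> U" for a
  proof -
    let ?F = "power_sum n d s a"
    have "eval_at a D \<noteq> 0" using a by (auto simp: U_def zero_locus_def)
    then have det: "det (gram s (d - 2 * k) (\<mu> k) (r k) a) \<noteq> 0" if "k \<le> d div 2" for k
      using that by (auto simp: eval)
    have sys: "\<exists>p q. dual_system n ?F k (d - k) p q (r k)" if "k \<le> d div 2" for k
      using that by (intro dual_system_if_gram_nonsingular[OF det] n \<mu>_mem) auto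
    \<comment> \<open>In degree zero the dual system already has positive size.\<close>
    have "?F \<noteq> 0"
    proof
      assume "?F = 0"
      moreover obtain p q where "dual_system n ?F 0 d p q (r 0)" using sys[of 0] by auto
      moreover have "0 < r 0" using assms(3) by (simp add: r_def)
      ultimately have "apolar 0 (p 0 * q 0) = (1::'k)" by (auto simp: dual_system_def)
      then show False by (simp add: apolar_def lin_ext_def dp_coeff_def)
    qed
    note F = power_sum_graded this
    have "hilbert_function n ?F k = r k" if k: "k \<le> d div 2" for k
    proof -
      have "k \<le> d" using k by simp
      obtain p q where sys: "dual_system n ?F k (d - k) p q (r k)" using sys k by blast
      have "t \<le> r k" if "dual_system n ?F k (d - k) p q t" for p q t
        using dual_system_le_monomials[OF that] dual_system_power_sum_le[OF that \<open>k \<le> d\<close>]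
        by (simp add: r_def card_monomials)
      then have "\<nexists>p q. dual_system n ?F k (d - k) p q (Suc (r k))"
        using not_less_eq_eq by blast
      then show ?thesis
        by (rule hilbert_function_eq_dual_system[OF F \<open>k \<le> d\<close> sys])
    qed
    moreover have "hilbert_function n ?F k = hilbert_function n ?F (d - k)" if "k \<le> d" for k
      by (rule hilbert_function_symmetric[OF F that])
    ultimately show ?thesis unfolding Let_def r_def by blast
  qed
  ultimately show ?thesis by blast
qed

end
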